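(* (Validity of entanglement swapping.) Let $\mathcal{C}$ be a dagger compact closed category with dagger biproducts, let $Q$ be an object of $\mathcal{C}$ and let $\beta_1,\beta_2,\beta_3,\beta_4\colon Q\to Q$ be unitary arrows. For $1\le i\le4$ let $\gamma_i=(\beta_i)_\ast\colon Q^\ast\to Q^\ast$ and let $\mathrm{P}_i=(w_Q\otimes Q^\ast)\circ\ulcorner\gamma_i\urcorner\circ\llcorner\beta_i\lrcorner\colon Q\otimes Q^\ast\to Q\otimes Q^\ast$. Let $$\Theta=\mathbf{1}_{Q^\ast}\otimes\big(\langle\mathrm{P}_i\rangle_{i=1}^{4}\otimes\mathbf{1}_Q\big)\colon Q^\ast\otimes((Q\otimes Q^\ast)\otimes Q)\to Q^\ast\otimes((4\cdot(Q\otimes Q^\ast))\otimes Q),$$ $$\varphi=\Big(4\cdot\big((\sigma_{Q,Q^\ast}\otimes\mathbf{1}_{Q^\ast\otimes Q})\circ\alpha^{-1}_{Q\otimes Q^\ast,Q^\ast,Q}\circ(\sigma_{Q^\ast,Q\otimes Q^\ast}\otimes\mathbf{1}_Q)\circ\alpha_{Q^\ast,Q\otimes Q^\ast,Q}\big)\Big)\circ\tau\circ(\mathbf{1}_{Q^\ast}\otimes\upsilon),$$ $$\zeta=\bigoplus_{i=1}^{4}\big((\mathbf{1}_{Q^\ast}\otimes\beta_i)\otimes(\mathbf{1}_{Q^\ast}\otimes\beta_i^{-1})\big)\colon4\cdot((Q^\ast\otimes Q)\otimes(Q^\ast\otimes Q))\to4\cdot((Q^\ast\otimes Q)\otimes(Q^\ast\otimes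 Q)).$$ Then, as arrows from $I\otimes I$ to $4\cdot((Q^\ast\otimes Q)\otimes(Q^\ast\otimes Q))$, $$\zeta\circ\varphi\circ\Theta\circ(\mathbf{1}_{Q^\ast}\otimes\alpha_{Q,Q^\ast,Q})\circ\alpha^{-1}_{Q^\ast,Q,Q^\ast\otimes Q}\circ(\ulcorner\mathbf{1}_Q\urcorner\otimes\ulcorner\mathbf{1}_Q\urcorner)=\langle\ulcorner\mathbf{1}_Q\urcorner\otimes\ulcorner\mathbf{1}_Q\urcorner\rangle_{i=1}^{4},$$ where all four components on the right-hand side are the same arrow.
   Context: A compact closed category is a symmetric monoidal category with natural isomorphisms $\alpha_{a,b,c}\colon a\otimes(b\otimes c)\to(a\otimes b)\otimes c$, $\lambda_a\colon I\otimes a\to a$, $\sigma_{a,b}\colon a\otimes b\to b\otimes a$, in which every object $a$ has a dual $a^\ast$ with $\eta_a\colon I\to a^\ast\otimes a$ and $\varepsilon_a\colon a\otimes a^\ast\to I$ satisfying $(a^\ast\otimes\varepsilon_a)\circ\alpha^{-1}_{a^\ast,a,a^\ast}\circ(\eta_a\otimes a^\ast)=\sigma_{I,a^\ast}$ and $(\varepsilon_a\otimes a)\circ\alpha_{a,a^\ast,a}\circ(a\otimes\eta_a)=\sigma_{a,I}$. It is dagger compact closed if it has an identity-on-objects involutive functor $\dagger\colon\mathcal{C}\to\mathcal{C}^{\mathrm{op}}$ with $(f\otimes g)^\dagger=f^\dagger\otimes g^\dagger$, $\alpha^\dagger=\alpha^{-1}$, $\lambda^\dagger=\lambda^{-1}$,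 $\sigma_{a,b}^\dagger=\sigma_{b,a}$, $\varepsilon_a^\dagger=\sigma_{a^\ast,a}\circ\eta_a$. Biproducts are dagger biproducts if $(\pi^i)^\dagger=\iota^i$. An arrow $f$ is unitary if $f^\dagger$ is its two-sided inverse. For $f\colon a\to b$: the name is $\ulcorner f\urcorner=(a^\ast\otimes f)\circ\eta_a\colon I\to a^\ast\otimes b$; the coname is $\llcorner f\lrcorner=\varepsilon_b\circ(f\otimes b^\ast)\colon a\otimes b^\ast\to I$; $f^\ast\colon b^\ast\to a^\ast$ is $\lambda_{a^\ast}\circ\sigma_{a^\ast,I}\circ(a^\ast\otimes\varepsilon_b)\circ\alpha^{-1}_{a^\ast,b,b^\ast}\circ((a^\ast\otimes f)\otimes b^\ast)\circ(\eta_a\otimes b^\ast)\circ\lambda^{-1}_{b^\ast}$; and $f_\ast=(f^\dagger)^\ast\colon a^\ast\to b^\ast$. $w_a\colon a^{\ast\ast}\to a$ is the canonical isomorphism $\lambda_a\circ(\varepsilon_{a^\ast}\otimes a)\circ(\sigma_{a^{\ast\ast},a^\ast}\otimes a)\circ\alpha_{a^{\ast\ast},a^\ast,a}\circ(a^{\ast\ast}\otimes\eta_a)\circ\sigma_{I,a^{\ast\ast}}\circ\lambda^{-1}_{a^{\ast\ast}}$. $4\cdot a$ and $4\cdot f$ denote the fourfold biproducts, associated to the left, of an object $a$ and an arrow $f$; $\langle f_i\rangle_{i=1}^4$ is the arrow into the biproduct with components $f_i$. $\upsilon\colon(4\cdot(Q\otimes Q^\ast))\otimes Q\to4\cdot((Q\otimes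 Q^\ast)\otimes Q)$ and $\tau\colon Q^\ast\otimes(4\cdot((Q\otimes Q^\ast)\otimes Q))\to4\cdot(Q^\ast\otimes((Q\otimes Q^\ast)\otimes Q))$ are the distributivity isomorphisms, with $i$-th components $\pi^i\otimes\mathbf{1}_Q$ and $\mathbf{1}_{Q^\ast}\otimes\pi^i$ respectively, $\pi^i$ being the $i$-th projection. *)

theory Defs
  imports Main
begin

text \<open>
  Categories are records with explicit carriers. The operations are total functions, and the
  axioms only constrain them on objects and on composable arrows. The composition
  \<open>g \<cdot> f\<close> is in applicative order. Tensor and biproduct are written \<open>\<otimes>\<close>, \<open>\<oplus>\<close> on objects
  and \<open>\<boxtimes>\<close>, \<open>\<boxplus>\<close> on arrows.
\<close>

subsection \<open>Categories\<close>

record ('o, 'a) category =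
  Obj :: "'o set"
  Arr :: "'a set"
  Dom :: "'a \<Rightarrow> 'o"
  Cod :: "'a \<Rightarrow> 'o"
  Id :: "'o \<Rightarrow> 'a" (\<open>\<one>\<index>[_]\<close>)
  Comp :: "'a \<Rightarrow> 'a \<Rightarrow> 'a" (infixr \<open>\<cdot>\<index>\<close> 55)

definition Hom :: "('o, 'a, 'm) category_scheme \<Rightarrow> 'o \<Rightarrow> 'o \<Rightarrow> 'a set"
  where "Hom C a b = {f \<in> Arr C. Dom C f = a \<and> Cod C f = b}"

locale category =
  fixes C :: "('o, 'a, 'm) category_scheme" (structure)
  assumes Dom_Obj: "f \<in> Arr C \<Longrightarrow> Dom C f \<in> Obj C"
    and Cod_Obj: "f \<in> Arr C \<Longrightarrow> Cod C f \<in> Obj C"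
    and Id_Hom: "a \<in> Obj C \<Longrightarrow> \<one>[a] \<in> Hom C a a"
    and Comp_Hom: "\<lbrakk>f \<in> Hom C a b; g \<in> Hom C b c\<rbrakk> \<Longrightarrow> g \<cdot> f \<in> Hom C a c"
    and Comp_Id: "f \<in> Hom C a b \<Longrightarrow> f \<cdot> \<one>[a] = f"
    and Id_Comp: "f \<in> Hom C a b \<Longrightarrow> \<one>[b] \<cdot> f = f"
    and Comp_assoc: "\<lbrakk>f \<in> Hom C a b; g \<in> Hom C b c; h \<in> Hom C c d\<rbrakk>
      \<Longrightarrow> (h \<cdot> g) \<cdot> f = h \<cdot> (g \<cdot> f)"

definition inverse_arrows :: "('o, 'a, 'm) category_scheme \<Rightarrow> 'a \<Rightarrow> 'a \<Rightarrow> bool"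
  where "inverse_arrows C f g \<longleftrightarrow>
    (\<exists>a b. f \<in> Hom C a b \<and> g \<in> Hom C b a \<and> g \<cdot> f = \<one>[a] \<and> f \<cdot> g = \<one>[b])"
  for C (structure)

definition iso :: "('o, 'a, 'm) category_scheme \<Rightarrow> 'a \<Rightarrow> bool"
  where "iso C f \<longleftrightarrow> (\<exists>g. inverse_arrows C f g)"

definition inv_arr :: "('o, 'a, 'm) category_scheme \<Rightarrow> 'a \<Rightarrow> 'a"
  where "inv_arr C f = (THE g. inverse_arrows C f g)"


subsection \<open>Symmetric monoidal categories\<close>

record ('o, 'a) symmetric_monoidal_category = "('o, 'a) category" +
  Unit :: 'o (\<open>\<I>\<index>\<close>)
  Tensor_obj :: "'o \<Rightarrow> 'o \<Rightarrow> 'o" (infix \<open>\<otimes>\<index>\<close> 70)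
  Tensor_arr :: "'a \<Rightarrow> 'a \<Rightarrow> 'a" (infix \<open>\<boxtimes>\<index>\<close> 70)
  Associator :: "'o \<Rightarrow> 'o \<Rightarrow> 'o \<Rightarrow> 'a" (\<open>\<a>\<index>[_,/ _,/ _]\<close>)
  Left_unitor :: "'o \<Rightarrow> 'a" (\<open>\<l>\<index>[_]\<close>)
  Symmetry :: "'o \<Rightarrow> 'o \<Rightarrow> 'a" (\<open>\<s>\<index>[_,/ _]\<close>)

text \<open>The right unitor is the derived isomorphism \<open>\<l>[a] \<cdot> \<s>[a, \<I>]\<close>.\<close>

locale symmetric_monoidal_category = category C
  for C :: "('o, 'a, 'm) symmetric_monoidal_category_scheme" (structure) +
  assumes Unit_Obj: "\<I> \<in> Obj C"
    and Tensor_Obj: "\<lbrakk>a \<in> Obj C; b \<in> Obj C\<rbrakk> \<Longrightarrow> a \<otimes> b \<in> Obj C"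
    and Tensor_Hom: "\<lbrakk>f \<in> Hom C a b; g \<in> Hom C c d\<rbrakk>
      \<Longrightarrow> f \<boxtimes> g \<in> Hom C (a \<otimes> c) (b \<otimes> d)"
    and Tensor_Id: "\<lbrakk>a \<in> Obj C; b \<in> Obj C\<rbrakk> \<Longrightarrow> \<one>[a] \<boxtimes> \<one>[b] = \<one>[a \<otimes> b]"
    and Tensor_Comp: "\<lbrakk>f \<in> Hom C a b; f' \<in> Hom C b c; g \<in> Hom C x y; g' \<in> Hom C y z\<rbrakk>
      \<Longrightarrow> (f' \<cdot> f) \<boxtimes> (g' \<cdot> g) = (f' \<boxtimes> g') \<cdot> (f \<boxtimes> g)"
    and Associator_Hom: "\<lbrakk>a \<in> Obj C; b \<in> Obj C; c \<in> Obj C\<rbrakk>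
      \<Longrightarrow> \<a>[a, b, c] \<in> Hom C (a \<otimes> (b \<otimes> c)) ((a \<otimes> b) \<otimes> c)"
    and Associator_iso: "\<lbrakk>a \<in> Obj C; b \<in> Obj C; c \<in> Obj C\<rbrakk> \<Longrightarrow> iso C \<a>[a, b, c]"
    and Associator_natural:
      "\<lbrakk>f \<in> Hom C a a'; g \<in> Hom C b b'; h \<in> Hom C c c'\<rbrakk>
      \<Longrightarrow> \<a>[a', b', c'] \<cdot> (f \<boxtimes> (g \<boxtimes> h)) = ((f \<boxtimes> g) \<boxtimes> h) \<cdot> \<a>[a, b, c]"
    and Left_unitor_Hom: "a \<in> Obj C \<Longrightarrow> \<l>[a] \<in> Hom C (\<I> \<otimes> a) a"
    and Left_unitor_iso: "a \<in> Obj C \<Longrightarrow> iso C \<l>[a]"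
    and Left_unitor_natural: "f \<in> Hom C a b \<Longrightarrow> \<l>[b] \<cdot> (\<one>[\<I>] \<boxtimes> f) = f \<cdot> \<l>[a]"
    and Symmetry_Hom: "\<lbrakk>a \<in> Obj C; b \<in> Obj C\<rbrakk> \<Longrightarrow> \<s>[a, b] \<in> Hom C (a \<otimes> b) (b \<otimes> a)"
    and Symmetry_natural: "\<lbrakk>f \<in> Hom C a a'; g \<in> Hom C b b'\<rbrakk>
      \<Longrightarrow> \<s>[a', b'] \<cdot> (f \<boxtimes> g) = (g \<boxtimes> f) \<cdot> \<s>[a, b]"
    and Symmetry_inverse: "\<lbrakk>a \<in> Obj C; b \<in> Obj C\<rbrakk> \<Longrightarrow> \<s>[b, a] \<cdot> \<s>[a, b] = \<one>[a \<otimes> b]"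
    and pentagon: "\<lbrakk>a \<in> Obj C; b \<in> Obj C; c \<in> Obj C; d \<in> Obj C\<rbrakk>
      \<Longrightarrow> \<a>[a \<otimes> b, c, d] \<cdot> \<a>[a, b, c \<otimes> d]
        = (\<a>[a, b, c] \<boxtimes> \<one>[d]) \<cdot> \<a>[a, b \<otimes> c, d] \<cdot> (\<one>[a] \<boxtimes> \<a>[b, c, d])"
    and triangle: "\<lbrakk>a \<in> Obj C; b \<in> Obj C\<rbrakk>
      \<Longrightarrow> ((\<l>[a] \<cdot> \<s>[a, \<I>]) \<boxtimes> \<one>[b]) \<cdot> \<a>[a, \<I>, b] = \<one>[a] \<boxtimes> \<l>[b]"
    and unitors_Unit: "\<l>[\<I>] \<cdot> \<s>[\<I>, \<I>] = \<l>[\<I>]"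
    and hexagon: "\<lbrakk>a \<in> Obj C; b \<in> Obj C; c \<in> Obj C\<rbrakk>
      \<Longrightarrow> \<a>[c, a, b] \<cdot> \<s>[a \<otimes> b, c] \<cdot> \<a>[a, b, c]
        = (\<s>[a, c] \<boxtimes> \<one>[b]) \<cdot> \<a>[a, c, b] \<cdot> (\<one>[a] \<boxtimes> \<s>[b, c])"


subsection \<open>Compact closed categories\<close>

record ('o, 'a) compact_closed_category = "('o, 'a) symmetric_monoidal_category" +
  Dual :: "'o \<Rightarrow> 'o" (\<open>_\<^sup>\<star>\<index>\<close> [1000] 999)
  Eta :: "'o \<Rightarrow> 'a" (\<open>\<eta>\<index>[_]\<close>)
  Eps :: "'o \<Rightarrow> 'a" (\<open>\<epsilon>\<index>[_]\<close>)

locale compact_closed_category = symmetric_monoidal_category C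
  for C :: "('o, 'a, 'm) compact_closed_category_scheme" (structure) +
  assumes Dual_Obj: "a \<in> Obj C \<Longrightarrow> a\<^sup>\<star> \<in> Obj C"
    and Eta_Hom: "a \<in> Obj C \<Longrightarrow> \<eta>[a] \<in> Hom C \<I> (a\<^sup>\<star> \<otimes> a)"
    and Eps_Hom: "a \<in> Obj C \<Longrightarrow> \<epsilon>[a] \<in> Hom C (a \<otimes> a\<^sup>\<star>) \<I>"
    and snake_Dual: "a \<in> Obj C \<Longrightarrow>
      (\<one>[a\<^sup>\<star>] \<boxtimes> \<epsilon>[a]) \<cdot> inv_arr C \<a>[a\<^sup>\<star>, a, a\<^sup>\<star>] \<cdot> (\<eta>[a] \<boxtimes> \<one>[a\<^sup>\<star>]) = \<s>[\<I>, a\<^sup>\<star>]"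
    and snake: "a \<in> Obj C \<Longrightarrow>
      (\<epsilon>[a] \<boxtimes> \<one>[a]) \<cdot> \<a>[a, a\<^sup>\<star>, a] \<cdot> (\<one>[a] \<boxtimes> \<eta>[a]) = \<s>[a, \<I>]"

definition name :: "('o, 'a, 'm) compact_closed_category_scheme \<Rightarrow> 'a \<Rightarrow> 'a"
    (\<open>\<ulcorner>_\<urcorner>\<index>\<close>)
  where "\<ulcorner>f\<urcorner> = (\<one>[(Dom C f)\<^sup>\<star>] \<boxtimes> f) \<cdot> \<eta>[Dom C f]"
  for C (structure)

definition coname :: "('o, 'a, 'm) compact_closed_category_scheme \<Rightarrow> 'a \<Rightarrow> 'a"
    (\<open>\<llcorner>_\<lrcorner>\<index>\<close>)
  where "\<llcorner>f\<lrcorner> = \<epsilon>[Cod C f] \<cdot> (f \<boxtimes> \<one>[(Cod C f)\<^sup>\<star>])"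
  for C (structure)

text \<open>\<open>upper_star C f\<close> is \<open>f\<^sup>*\<close>, from \<open>b\<^sup>\<star>\<close> to \<open>a\<^sup>\<star>\<close> for \<open>f\<close> from \<open>a\<close> to \<open>b\<close>.\<close>

definition upper_star :: "('o, 'a, 'm) compact_closed_category_scheme \<Rightarrow> 'a \<Rightarrow> 'a"
  where "upper_star C f = (let a = Dom C f; b = Cod C f in
    \<l>[a\<^sup>\<star>] \<cdot> \<s>[a\<^sup>\<star>, \<I>] \<cdot> (\<one>[a\<^sup>\<star>] \<boxtimes> \<epsilon>[b]) \<cdot> inv_arr C \<a>[a\<^sup>\<star>, b, b\<^sup>\<star>]
      \<cdot> ((\<one>[a\<^sup>\<star>] \<boxtimes> f) \<boxtimes> \<one>[b\<^sup>\<star>]) \<cdot> (\<eta>[a] \<boxtimes> \<one>[b\<^sup>\<star>]) \<cdot> inv_arr C \<l>[b\<^sup>\<star>])"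
  for C (structure)

text \<open>The canonical isomorphism from \<open>a\<^sup>\<star>\<^sup>\<star>\<close> to \<open>a\<close>.\<close>

definition double_dual :: "('o, 'a, 'm) compact_closed_category_scheme \<Rightarrow> 'o \<Rightarrow> 'a"
    (\<open>\<w>\<index>[_]\<close>)
  where "\<w>[a] =
    \<l>[a] \<cdot> (\<epsilon>[a\<^sup>\<star>] \<boxtimes> \<one>[a]) \<cdot> (\<s>[(a\<^sup>\<star>)\<^sup>\<star>, a\<^sup>\<star>] \<boxtimes> \<one>[a]) \<cdot> \<a>[(a\<^sup>\<star>)\<^sup>\<star>, a\<^sup>\<star>, a]
      \<cdot> (\<one>[(a\<^sup>\<star>)\<^sup>\<star>] \<boxtimes> \<eta>[a]) \<cdot> \<s>[\<I>, (a\<^sup>\<star>)\<^sup>\<star>] \<cdot> inv_arr C \<l>[(a\<^sup>\<star>)\<^sup>\<star>]"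
  for C (structure)


subsection \<open>Dagger compact closed categories\<close>

record ('o, 'a) dagger_compact_closed_category = "('o, 'a) compact_closed_category" +
  Dagger :: "'a \<Rightarrow> 'a" (\<open>_\<^sup>\<dagger>\<index>\<close> [1000] 999)

locale dagger_compact_closed_category = compact_closed_category C
  for C :: "('o, 'a, 'm) dagger_compact_closed_category_scheme" (structure) +
  assumes Dagger_Hom: "f \<in> Hom C a b \<Longrightarrow> f\<^sup>\<dagger> \<in> Hom C b a"
    and Dagger_Id: "a \<in> Obj C \<Longrightarrow> \<one>[a]\<^sup>\<dagger> = \<one>[a]"
    and Dagger_Comp: "\<lbrakk>f \<in> Hom C a b; g \<in> Hom C b c\<rbrakk> \<Longrightarrow> (g \<cdot> f)\<^sup>\<dagger> = f\<^sup>\<dagger> \<cdot> g\<^sup>\<dagger>"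
    and Dagger_Dagger: "f \<in> Arr C \<Longrightarrow> (f\<^sup>\<dagger>)\<^sup>\<dagger> = f"
    and Dagger_Tensor: "\<lbrakk>f \<in> Arr C; g \<in> Arr C\<rbrakk> \<Longrightarrow> (f \<boxtimes> g)\<^sup>\<dagger> = f\<^sup>\<dagger> \<boxtimes> g\<^sup>\<dagger>"
    and Dagger_Associator: "\<lbrakk>a \<in> Obj C; b \<in> Obj C; c \<in> Obj C\<rbrakk>
      \<Longrightarrow> \<a>[a, b, c]\<^sup>\<dagger> = inv_arr C \<a>[a, b, c]"
    and Dagger_Left_unitor: "a \<in> Obj C \<Longrightarrow> \<l>[a]\<^sup>\<dagger> = inv_arr C \<l>[a]"
    and Dagger_Symmetry: "\<lbrakk>a \<in> Obj C; b \<in> Obj C\<rbrakk> \<Longrightarrow> \<s>[a, b]\<^sup>\<dagger> = \<s>[b, a]"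
    and Dagger_Eps: "a \<in> Obj C \<Longrightarrow> \<epsilon>[a]\<^sup>\<dagger> = \<s>[a\<^sup>\<star>, a] \<cdot> \<eta>[a]"

definition unitary :: "('o, 'a, 'm) dagger_compact_closed_category_scheme \<Rightarrow> 'a \<Rightarrow> bool"
  where "unitary C f \<longleftrightarrow> inverse_arrows C f (f\<^sup>\<dagger>)"
  for C (structure)

definition lower_star :: "('o, 'a, 'm) dagger_compact_closed_category_scheme \<Rightarrow> 'a \<Rightarrow> 'a"
  where "lower_star C f = upper_star C (f\<^sup>\<dagger>)"
  for C (structure)


subsection \<open>Dagger biproducts\<close>

record ('o, 'a) dagger_compact_closed_biproduct_category =
    "('o, 'a) dagger_compact_closed_category" +
  Zero :: 'o (\<open>\<zero>\<index>\<close>)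
  Biprod_obj :: "'o \<Rightarrow> 'o \<Rightarrow> 'o" (infixl \<open>\<oplus>\<index>\<close> 65)
  Proj1 :: "'o \<Rightarrow> 'o \<Rightarrow> 'a" (\<open>\<p>\<^sub>1\<index>[_,/ _]\<close>)
  Proj2 :: "'o \<Rightarrow> 'o \<Rightarrow> 'a" (\<open>\<p>\<^sub>2\<index>[_,/ _]\<close>)
  Inj1 :: "'o \<Rightarrow> 'o \<Rightarrow> 'a" (\<open>\<i>\<^sub>1\<index>[_,/ _]\<close>)
  Inj2 :: "'o \<Rightarrow> 'o \<Rightarrow> 'a" (\<open>\<i>\<^sub>2\<index>[_,/ _]\<close>)

definition zero_arr ::
    "('o, 'a, 'm) dagger_compact_closed_biproduct_category_scheme \<Rightarrow> 'o \<Rightarrow> 'o \<Rightarrow> 'a"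
  where "zero_arr C a b = (THE g. g \<in> Hom C \<zero> b) \<cdot> (THE f. f \<in> Hom C a \<zero>)"
  for C (structure)

locale dagger_compact_closed_biproduct_category = dagger_compact_closed_category C
  for C :: "('o, 'a, 'm) dagger_compact_closed_biproduct_category_scheme" (structure) +
  assumes Zero_Obj: "\<zero> \<in> Obj C"
    and Zero_initial: "a \<in> Obj C \<Longrightarrow> \<exists>!f. f \<in> Hom C \<zero> a"
    and Zero_terminal: "a \<in> Obj C \<Longrightarrow> \<exists>!f. f \<in> Hom C a \<zero>"
    and Biprod_Obj: "\<lbrakk>a \<in> Obj C; b \<in> Obj C\<rbrakk> \<Longrightarrow> a \<oplus> b \<in> Obj C"
    and Proj1_Hom: "\<lbrakk>a \<in> Obj C; b \<in> Obj C\<rbrakk> \<Longrightarrow> \<p>\<^sub>1[a, b] \<in> Hom C (a \<oplus> b) a"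
    and Proj2_Hom: "\<lbrakk>a \<in> Obj C; b \<in> Obj C\<rbrakk> \<Longrightarrow> \<p>\<^sub>2[a, b] \<in> Hom C (a \<oplus> b) b"
    and Inj1_Hom: "\<lbrakk>a \<in> Obj C; b \<in> Obj C\<rbrakk> \<Longrightarrow> \<i>\<^sub>1[a, b] \<in> Hom C a (a \<oplus> b)"
    and Inj2_Hom: "\<lbrakk>a \<in> Obj C; b \<in> Obj C\<rbrakk> \<Longrightarrow> \<i>\<^sub>2[a, b] \<in> Hom C b (a \<oplus> b)"
    and Biprod_product: "\<lbrakk>f \<in> Hom C c a; g \<in> Hom C c b\<rbrakk>
      \<Longrightarrow> \<exists>!h. h \<in> Hom C c (a \<oplus> b) \<and> \<p>\<^sub>1[a, b] \<cdot> h = f \<and> \<p>\<^sub>2[a, b] \<cdot> h = g"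
    and Biprod_coproduct: "\<lbrakk>f \<in> Hom C a c; g \<in> Hom C b c\<rbrakk>
      \<Longrightarrow> \<exists>!h. h \<in> Hom C (a \<oplus> b) c \<and> h \<cdot> \<i>\<^sub>1[a, b] = f \<and> h \<cdot> \<i>\<^sub>2[a, b] = g"
    and Proj1_Inj1: "\<lbrakk>a \<in> Obj C; b \<in> Obj C\<rbrakk> \<Longrightarrow> \<p>\<^sub>1[a, b] \<cdot> \<i>\<^sub>1[a, b] = \<one>[a]"
    and Proj2_Inj2: "\<lbrakk>a \<in> Obj C; b \<in> Obj C\<rbrakk> \<Longrightarrow> \<p>\<^sub>2[a, b] \<cdot> \<i>\<^sub>2[a, b] = \<one>[b]"
    and Proj1_Inj2: "\<lbrakk>a \<in> Obj C; b \<in> Obj C\<rbrakk> \<Longrightarrow> \<p>\<^sub>1[a, b] \<cdot> \<i>\<^sub>2[a, b] = zero_arr C b a"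
    and Proj2_Inj1: "\<lbrakk>a \<in> Obj C; b \<in> Obj C\<rbrakk> \<Longrightarrow> \<p>\<^sub>2[a, b] \<cdot> \<i>\<^sub>1[a, b] = zero_arr C a b"
    and Dagger_Proj1: "\<lbrakk>a \<in> Obj C; b \<in> Obj C\<rbrakk> \<Longrightarrow> \<p>\<^sub>1[a, b]\<^sup>\<dagger> = \<i>\<^sub>1[a, b]"
    and Dagger_Proj2: "\<lbrakk>a \<in> Obj C; b \<in> Obj C\<rbrakk> \<Longrightarrow> \<p>\<^sub>2[a, b]\<^sup>\<dagger> = \<i>\<^sub>2[a, b]"

definition pairing ::
    "('o, 'a, 'm) dagger_compact_closed_biproduct_category_scheme \<Rightarrow> 'a \<Rightarrow> 'a \<Rightarrow> 'a"
  where "pairing C f g = (let a = Cod C f; b = Cod C g in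
    THE h. h \<in> Hom C (Dom C f) (a \<oplus> b) \<and> \<p>\<^sub>1[a, b] \<cdot> h = f \<and> \<p>\<^sub>2[a, b] \<cdot> h = g)"
  for C (structure)

definition biprod_arr ::
    "('o, 'a, 'm) dagger_compact_closed_biproduct_category_scheme \<Rightarrow> 'a \<Rightarrow> 'a \<Rightarrow> 'a"
    (infixl \<open>\<boxplus>\<index>\<close> 65)
  where "f \<boxplus> g =
    pairing C (f \<cdot> \<p>\<^sub>1[Dom C f, Dom C g]) (g \<cdot> \<p>\<^sub>2[Dom C f, Dom C g])"
  for C (structure)

text \<open>
  Fourfold biproducts, associated to the left. Families \<open>f\<close> of four arrows are indexed
  by \<open>1, \<dots>, 4\<close>; \<open>proj4 C a i\<close> is the \<open>i\<close>-th projection from \<open>4 \<cdot> a\<close> for \<open>i\<close> in this range,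
  and \<open>4 \<cdot> f\<close> is \<open>sum4 C (\<lambda>_. f)\<close>.
\<close>

definition copies4 ::
    "('o, 'a, 'm) dagger_compact_closed_biproduct_category_scheme \<Rightarrow> 'o \<Rightarrow> 'o"
  where "copies4 C a = ((a \<oplus> a) \<oplus> a) \<oplus> a"
  for C (structure)

definition proj4 ::
    "('o, 'a, 'm) dagger_compact_closed_biproduct_category_scheme \<Rightarrow> 'o \<Rightarrow> nat \<Rightarrow> 'a"
  where "proj4 C a i =
    (if i = 1 then \<p>\<^sub>1[a, a] \<cdot> \<p>\<^sub>1[a \<oplus> a, a] \<cdot> \<p>\<^sub>1[(a \<oplus> a) \<oplus> a, a]
     else if i = 2 then \<p>\<^sub>2[a, a] \<cdot> \<p>\<^sub>1[a \<oplus> a, a] \<cdot> \<p>\<^sub>1[(a \<oplus> a) \<oplus> a, a]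
     else if i = 3 then \<p>\<^sub>2[a \<oplus> a, a] \<cdot> \<p>\<^sub>1[(a \<oplus> a) \<oplus> a, a]
     else \<p>\<^sub>2[(a \<oplus> a) \<oplus> a, a])"
  for C (structure)

definition tuple4 ::
    "('o, 'a, 'm) dagger_compact_closed_biproduct_category_scheme \<Rightarrow> (nat \<Rightarrow> 'a) \<Rightarrow> 'a"
  where "tuple4 C f = pairing C (pairing C (pairing C (f 1) (f 2)) (f 3)) (f 4)"

definition sum4 ::
    "('o, 'a, 'm) dagger_compact_closed_biproduct_category_scheme \<Rightarrow> (nat \<Rightarrow> 'a) \<Rightarrow> 'a"
  where "sum4 C f = ((f 1 \<boxplus> f 2) \<boxplus> f 3) \<boxplus> f 4"
  for C (structure)

end

theory Submission
  imports Defs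
begin

text \<open>
  Both sides are arrows into a fourfold biproduct, so it suffices to compare their four
  projections. The distributivity arrows \<open>\<upsilon>\<close> and \<open>\<tau>\<close> are tuples of whiskered projections, and
  \<open>\<phi>\<close> and \<open>\<zeta>\<close> are built from direct sums. Hence the \<open>i\<close>-th projection of the left-hand side is
  the single branch of the protocol in which the measurement has outcome \<open>i\<close>, with \<open>P i\<close> in
  place of the tuple of all projectors.

  Such a branch is treated by \<open>swapping_branch\<close>, for a unitary \<open>f\<close> on \<open>Q\<close>. The arrow \<open>P\<close> factors
  through the unit object, as a coname (an effect on the two inner systems) followed by a state
  on them. By the snake equation, the effect applied to the two Bell states
  \<open>\<eta>[Q] \<boxtimes> \<eta>[Q]\<close> leaves the name of \<open>f\<close> on the two outer systems (\<open>yank\<close>). The fresh state on the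
  inner systems is the name of \<open>lower_star C f\<close>, with \<open>\<w>[Q]\<close> applied on the left; up to a
  symmetry it is the name of the dagger of \<open>f\<close> (\<open>name_lower_star\<close>), because \<open>\<w>[Q]\<close> carries the
  unit of the dual object to that of \<open>Q\<close> (\<open>double_dual_Eta\<close>) and because an arrow slides
  around \<open>\<eta>\<close> by turning into its transpose (\<open>upper_star_Eta\<close>). The symmetries in \<open>\<phi>\<close> only move
  the inner pair past one outer system, so that a pair created from the unit ends up beside the
  outer pair (\<open>rearrangement\<close>). What remains is the tensor product of the names of the dagger of
  \<open>f\<close> and of \<open>f\<close>, and the corrections \<open>f\<close> and \<open>f\<close> inverse turn both factors into Bell states.

  The category need not be strict, so each of these steps carries associators and unitors.
  Beyond the axioms they need only the two compatibilities of the unitors with the tensor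
  product (\<open>Left_unitor_Tensor\<close>, \<open>Right_unitor_Tensor\<close>) and one consequence of two hexagons
  (\<open>Symmetry_hexagon_pair\<close>).
\<close>

section \<open>Composition and inverses\<close>

context category
begin

text \<open>
  The axioms describe types by hom-sets, which leaves the middle object of a composite
  undetermined. The rules below state the same facts with domains and codomains, so that the
  simplifier can discharge typing conditions by computation.
\<close>

lemma Hom_iff: "f \<in> Hom C a b \<longleftrightarrow> f \<in> Arr C \<and> Dom C f = a \<and> Cod C f = b"
  by (auto simp: Hom_def)

declare Dom_Obj [simp] Cod_Obj [simp]

lemma Id_type [simp]:
  assumes "a \<in> Obj C"
  shows "\<one>[a] \<in> Arr C" "Dom C \<one>[a] = a" "Cod C \<one>[a] = a"
  using Id_Hom [OF assms] by (auto simp: Hom_iff)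

lemma Comp_type [simp]:
  assumes "f \<in> Arr C" "g \<in> Arr C" "Dom C g = Cod C f"
  shows "g \<cdot> f \<in> Arr C" "Dom C (g \<cdot> f) = Dom C f" "Cod C (g \<cdot> f) = Cod C g"
  using Comp_Hom [of f "Dom C f" "Cod C f" g "Cod C g"] assms by (auto simp: Hom_iff)

lemma Comp_Id_Dom [simp]: "\<lbrakk>f \<in> Arr C; Dom C f = a\<rbrakk> \<Longrightarrow> f \<cdot> \<one>[a] = f"
  by (rule Comp_Id) (auto simp: Hom_iff)

lemma Id_Cod_Comp [simp]: "\<lbrakk>f \<in> Arr C; Cod C f = b\<rbrakk> \<Longrightarrow> \<one>[b] \<cdot> f = f"
  by (rule Id_Comp) (auto simp: Hom_iff)

lemma Comp_assoc_right [simp]: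
  "\<lbrakk>f \<in> Arr C; g \<in> Arr C; h \<in> Arr C; Dom C g = Cod C f; Dom C h = Cod C g\<rbrakk>
    \<Longrightarrow> (h \<cdot> g) \<cdot> f = h \<cdot> g \<cdot> f"
  by (rule Comp_assoc) (auto simp: Hom_iff)

text \<open>Composites are kept associated to the right; this applies an equation between composites
  in front of a further arrow.\<close>

lemma Comp_eq_extend:
  assumes "g \<cdot> f = k" "f \<in> Arr C" "g \<in> Arr C" "h \<in> Arr C" "Dom C g = Cod C f" "Dom C f = Cod C h"
  shows "g \<cdot> f \<cdot> h = k \<cdot> h"
  using assms Comp_assoc_right by metis

lemma inverse_arrows_unique:
  assumes "inverse_arrows C f g" "inverse_arrows C f h"
  shows "g = h"
proof -
  obtain a b where g: "f \<in> Hom C a b" "g \<in> Hom C b a" "g \<cdot> f = \<one>[a]" "f \<cdot> g = \<one>[b]"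
    using assms(1) by (auto simp: inverse_arrows_def)
  have h: "h \<in> Hom C b a" "f \<cdot> h = \<one>[b]"
    using assms(2) g(1) by (auto simp: inverse_arrows_def Hom_iff)
  have "g = g \<cdot> (f \<cdot> h)" unfolding h(2) using g(2) by (rule Comp_Id [symmetric])
  also have "\<dots> = (g \<cdot> f) \<cdot> h" using h(1) g(1,2) by (rule Comp_assoc [symmetric])
  also have "\<dots> = h" unfolding g(3) using h(1) by (rule Id_Comp)
  finally show ?thesis .
qed

lemma inv_arr_eq: "inverse_arrows C f g \<Longrightarrow> inv_arr C f = g"
  unfolding inv_arr_def using inverse_arrows_unique by blast

lemma inv_arr_props:
  assumes "iso C f"
  shows "f \<in> Arr C" "inv_arr C f \<in> Arr C" "Dom C (inv_arr C f) = Cod C f"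
    "Cod C (inv_arr C f) = Dom C f"
    "inv_arr C f \<cdot> f = \<one>[Dom C f]" "f \<cdot> inv_arr C f = \<one>[Cod C f]"
proof -
  obtain g where g: "inverse_arrows C f g" using assms by (auto simp: iso_def)
  then have "inv_arr C f = g" by (rule inv_arr_eq)
  with g show "f \<in> Arr C" "inv_arr C f \<in> Arr C" "Dom C (inv_arr C f) = Cod C f"
    "Cod C (inv_arr C f) = Dom C f"
    "inv_arr C f \<cdot> f = \<one>[Dom C f]" "f \<cdot> inv_arr C f = \<one>[Cod C f]"
    by (auto simp: inverse_arrows_def Hom_iff)
qed

lemma iso_cancel_left:
  assumes "iso C f" "g \<in> Arr C" "h \<in> Arr C" "Cod C g = Dom C f" "Cod C h = Dom C f"
    and eq: "f \<cdot> g = f \<cdot> h"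
  shows "g = h"
proof -
  note f = inv_arr_props [OF assms(1)]
  have *: "inv_arr C f \<cdot> f \<cdot> k = k" if "k \<in> Arr C" "Cod C k = Dom C f" for k
    by (subst Comp_eq_extend [OF f(5)]) (simp_all add: that f(1-4))
  show ?thesis
    using * [OF assms(2,4)] * [OF assms(3,5)] unfolding eq by (rule trans [OF sym])
qed

lemma iso_cancel_right:
  assumes "iso C f" "g \<in> Arr C" "h \<in> Arr C" "Dom C g = Cod C f" "Dom C h = Cod C f"
    and eq: "g \<cdot> f = h \<cdot> f"
  shows "g = h"
proof -
  note f = inv_arr_props [OF assms(1)]
  have *: "(k \<cdot> f) \<cdot> inv_arr C f = k" if "k \<in> Arr C" "Dom C k = Cod C f" for k
    by (simp add: that f)
  show ?thesis
    using * [OF assms(2,4)] * [OF assms(3,5)] unfolding eq by (rule trans [OF sym])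
qed

end

section \<open>Coherence in symmetric monoidal categories\<close>

context symmetric_monoidal_category
begin

declare Unit_Obj [simp] Tensor_Obj [simp] Tensor_Id [simp]

lemma Tensor_type [simp]:
  assumes "f \<in> Arr C" "g \<in> Arr C"
  shows "f \<boxtimes> g \<in> Arr C" "Dom C (f \<boxtimes> g) = Dom C f \<otimes> Dom C g"
    "Cod C (f \<boxtimes> g) = Cod C f \<otimes> Cod C g"
  using Tensor_Hom [of f "Dom C f" "Cod C f" g "Dom C g" "Cod C g"] assms by (auto simp: Hom_iff)

lemma Associator_type [simp]:
  assumes "a \<in> Obj C" "b \<in> Obj C" "c \<in> Obj C"
  shows "\<a>[a, b, c] \<in> Arr C" "Dom C \<a>[a, b, c] = a \<otimes> (b \<otimes> c)"
    "Cod C \<a>[a, b, c] = (a \<otimes> b) \<otimes> c"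
  using Associator_Hom [OF assms] by (auto simp: Hom_iff)

lemma Left_unitor_type [simp]:
  assumes "a \<in> Obj C"
  shows "\<l>[a] \<in> Arr C" "Dom C \<l>[a] = \<I> \<otimes> a" "Cod C \<l>[a] = a"
  using Left_unitor_Hom [OF assms] by (auto simp: Hom_iff)

lemma Symmetry_type [simp]:
  assumes "a \<in> Obj C" "b \<in> Obj C"
  shows "\<s>[a, b] \<in> Arr C" "Dom C \<s>[a, b] = a \<otimes> b" "Cod C \<s>[a, b] = b \<otimes> a"
  using Symmetry_Hom [OF assms] by (auto simp: Hom_iff)

text \<open>Adjacent tensors of arrows are merged by interchange.\<close>

lemma interchange:
  "\<lbrakk>f \<in> Arr C; f' \<in> Arr C; g \<in> Arr C; g' \<in> Arr C; Dom C f' = Cod C f; Dom C g' = Cod C g\<rbrakk>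
    \<Longrightarrow> (f' \<boxtimes> g') \<cdot> (f \<boxtimes> g) = (f' \<cdot> f) \<boxtimes> (g' \<cdot> g)"
  by (rule Tensor_Comp [symmetric]) (auto simp: Hom_iff)

lemma interchange_extend:
  "\<lbrakk>f \<in> Arr C; f' \<in> Arr C; g \<in> Arr C; g' \<in> Arr C; Dom C f' = Cod C f; Dom C g' = Cod C g;
    h \<in> Arr C; Cod C h = Dom C f \<otimes> Dom C g\<rbrakk>
    \<Longrightarrow> (f' \<boxtimes> g') \<cdot> (f \<boxtimes> g) \<cdot> h = ((f' \<cdot> f) \<boxtimes> (g' \<cdot> g)) \<cdot> h"
  by (rule Comp_eq_extend [OF interchange]) auto

lemmas merge = interchange interchange_extend

lemma Associator_inv [simp]:
  assumes "a \<in> Obj C" "b \<in> Obj C" "c \<in> Obj C"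
  shows "inv_arr C \<a>[a, b, c] \<in> Arr C"
    "Dom C (inv_arr C \<a>[a, b, c]) = (a \<otimes> b) \<otimes> c"
    "Cod C (inv_arr C \<a>[a, b, c]) = a \<otimes> (b \<otimes> c)"
    "inv_arr C \<a>[a, b, c] \<cdot> \<a>[a, b, c] = \<one>[a \<otimes> (b \<otimes> c)]"
    "\<a>[a, b, c] \<cdot> inv_arr C \<a>[a, b, c] = \<one>[(a \<otimes> b) \<otimes> c]"
  using inv_arr_props [OF Associator_iso [OF assms]] assms by simp_all

lemma Left_unitor_inv [simp]:
  assumes "a \<in> Obj C"
  shows "inv_arr C \<l>[a] \<in> Arr C"
    "Dom C (inv_arr C \<l>[a]) = a" "Cod C (inv_arr C \<l>[a]) = \<I> \<otimes> a"
    "inv_arr C \<l>[a] \<cdot> \<l>[a] = \<one>[\<I> \<otimes> a]" "\<l>[a] \<cdot> inv_arr C \<l>[a] = \<one>[a]"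
  using inv_arr_props [OF Left_unitor_iso [OF assms]] assms by simp_all

lemma Associator_inv_extend [simp]:
  assumes "a \<in> Obj C" "b \<in> Obj C" "c \<in> Obj C" "h \<in> Arr C"
  shows "Cod C h = a \<otimes> (b \<otimes> c) \<Longrightarrow> inv_arr C \<a>[a, b, c] \<cdot> \<a>[a, b, c] \<cdot> h = h"
    "Cod C h = (a \<otimes> b) \<otimes> c \<Longrightarrow> \<a>[a, b, c] \<cdot> inv_arr C \<a>[a, b, c] \<cdot> h = h"
  using Comp_eq_extend [OF Associator_inv(4), of a b c h]
    Comp_eq_extend [OF Associator_inv(5), of a b c h] assms by simp_all

lemma Left_unitor_inv_extend [simp]:
  assumes "a \<in> Obj C" "h \<in> Arr C"
  shows "Cod C h = \<I> \<otimes> a \<Longrightarrow> inv_arr C \<l>[a] \<cdot> \<l>[a] \<cdot> h = h"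
    "Cod C h = a \<Longrightarrow> \<l>[a] \<cdot> inv_arr C \<l>[a] \<cdot> h = h"
  using Comp_eq_extend [OF Left_unitor_inv(4), of a h]
    Comp_eq_extend [OF Left_unitor_inv(5), of a h] assms by simp_all

lemma Symmetry_inverse_extend [simp]:
  "\<lbrakk>a \<in> Obj C; b \<in> Obj C; h \<in> Arr C; Cod C h = a \<otimes> b\<rbrakk> \<Longrightarrow> \<s>[b, a] \<cdot> \<s>[a, b] \<cdot> h = h"
  using Comp_eq_extend [OF Symmetry_inverse, of a b h] by simp

declare Symmetry_inverse [simp]

text \<open>Naturality, with the indices of the structural arrows read off the arrows.\<close>

lemma Associator_nat:
  "\<lbrakk>f \<in> Arr C; g \<in> Arr C; h \<in> Arr C\<rbrakk>
    \<Longrightarrow> \<a>[Cod C f, Cod C g, Cod C h] \<cdot> (f \<boxtimes> (g \<boxtimes> h))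
      = ((f \<boxtimes> g) \<boxtimes> h) \<cdot> \<a>[Dom C f, Dom C g, Dom C h]"
  by (rule Associator_natural) (auto simp: Hom_iff)

lemma Associator_inv_nat:
  assumes "f \<in> Arr C" "g \<in> Arr C" "h \<in> Arr C"
  shows "inv_arr C \<a>[Cod C f, Cod C g, Cod C h] \<cdot> ((f \<boxtimes> g) \<boxtimes> h)
      = (f \<boxtimes> (g \<boxtimes> h)) \<cdot> inv_arr C \<a>[Dom C f, Dom C g, Dom C h]"
proof (rule iso_cancel_left [OF Associator_iso [of "Cod C f" "Cod C g" "Cod C h"]])
  show "\<a>[Cod C f, Cod C g, Cod C h] \<cdot> inv_arr C \<a>[Cod C f, Cod C g, Cod C h] \<cdot> ((f \<boxtimes> g) \<boxtimes> h)
    = \<a>[Cod C f, Cod C g, Cod C h] \<cdot> (f \<boxtimes> (g \<boxtimes> h)) \<cdot> inv_arr C \<a>[Dom C f, Dom C g, Dom C h]"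
    using assms by (simp add: Comp_eq_extend [OF Associator_nat])
qed (use assms in simp_all)

lemma Left_unitor_nat:
  "f \<in> Arr C \<Longrightarrow> \<l>[Cod C f] \<cdot> (\<one>[\<I>] \<boxtimes> f) = f \<cdot> \<l>[Dom C f]"
  by (rule Left_unitor_natural) (auto simp: Hom_iff)

lemma Left_unitor_inv_nat:
  assumes "f \<in> Arr C"
  shows "inv_arr C \<l>[Cod C f] \<cdot> f = (\<one>[\<I>] \<boxtimes> f) \<cdot> inv_arr C \<l>[Dom C f]"
proof (rule iso_cancel_left [OF Left_unitor_iso [of "Cod C f"]])
  show "\<l>[Cod C f] \<cdot> inv_arr C \<l>[Cod C f] \<cdot> f
    = \<l>[Cod C f] \<cdot> (\<one>[\<I>] \<boxtimes> f) \<cdot> inv_arr C \<l>[Dom C f]"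
    using assms by (simp add: Comp_eq_extend [OF Left_unitor_nat])
qed (use assms in simp_all)

lemma Symmetry_nat:
  "\<lbrakk>f \<in> Arr C; g \<in> Arr C\<rbrakk>
    \<Longrightarrow> \<s>[Cod C f, Cod C g] \<cdot> (f \<boxtimes> g) = (g \<boxtimes> f) \<cdot> \<s>[Dom C f, Dom C g]"
  by (rule Symmetry_natural) (auto simp: Hom_iff)

lemma pentagon_inv:
  assumes a: "a \<in> Obj C" and b: "b \<in> Obj C" and c: "c \<in> Obj C" and d: "d \<in> Obj C"
  shows "(inv_arr C \<a>[a, b, c] \<boxtimes> \<one>[d]) \<cdot> \<a>[a \<otimes> b, c, d]
    = \<a>[a, b \<otimes> c, d] \<cdot> (\<one>[a] \<boxtimes> \<a>[b, c, d]) \<cdot> inv_arr C \<a>[a, b, c \<otimes> d]" (is "?L = ?R")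
proof -
  have "?L = (inv_arr C \<a>[a, b, c] \<boxtimes> \<one>[d]) \<cdot> (\<a>[a \<otimes> b, c, d] \<cdot> \<a>[a, b, c \<otimes> d])
      \<cdot> inv_arr C \<a>[a, b, c \<otimes> d]"
    using a b c d by simp
  also have "\<dots> = ?R"
    unfolding pentagon [OF a b c d] using a b c d by (simp add: interchange_extend)
  finally show ?thesis .
qed

text \<open>By naturality, \<open>\<l>\<close> exhibits tensoring with the unit as isomorphic to the identity functor,
  so that tensoring with the unit is faithful.\<close>

lemma Unit_Tensor_cancel:
  assumes "f \<in> Arr C" "g \<in> Arr C" "Dom C f = Dom C g" "Cod C f = Cod C g"
    and "\<one>[\<I>] \<boxtimes> f = \<one>[\<I>] \<boxtimes> g"
  shows "f = g"
proof (rule iso_cancel_right [OF Left_unitor_iso [of "Dom C f"]])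
  show "f \<cdot> \<l>[Dom C f] = g \<cdot> \<l>[Dom C f]"
    using Left_unitor_nat [of f] Left_unitor_nat [of g] assms by simp
qed (use assms in simp_all)

text \<open>
  Kelly's argument: after tensoring with the unit on the left and composing with an associator,
  both sides are computed from the pentagon at \<open>\<I>\<close>, \<open>\<I>\<close>, \<open>a\<close>, \<open>b\<close> and two instances of the
  triangle. Both operations can be cancelled.
\<close>

lemma Left_unitor_Tensor:
  assumes a: "a \<in> Obj C" and b: "b \<in> Obj C"
  shows "(\<l>[a] \<boxtimes> \<one>[b]) \<cdot> \<a>[\<I>, a, b] = \<l>[a \<otimes> b]"
proof (rule sym, rule Unit_Tensor_cancel)
  let ?r = "\<l>[\<I>] \<cdot> \<s>[\<I>, \<I>]"
  have "\<a>[\<I>, a, b] \<cdot> (\<one>[\<I>] \<boxtimes> \<l>[a \<otimes> b]) = \<a>[\<I>, a, b] \<cdot> (?r \<boxtimes> (\<one>[a] \<boxtimes> \<one>[b])) \<cdot> \<a>[\<I>, \<I>, a \<otimes> b]"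
    using triangle [of \<I> "a \<otimes> b"] a b by simp
  also have "\<dots> = ((?r \<boxtimes> \<one>[a]) \<boxtimes> \<one>[b]) \<cdot> \<a>[\<I> \<otimes> \<I>, a, b] \<cdot> \<a>[\<I>, \<I>, a \<otimes> b]"
    using Comp_eq_extend [OF Associator_nat [of ?r "\<one>[a]" "\<one>[b]"], of "\<a>[\<I>, \<I>, a \<otimes> b]"] a b
    by simp
  also have "\<dots> = ((?r \<boxtimes> \<one>[a]) \<boxtimes> \<one>[b]) \<cdot> (\<a>[\<I>, \<I>, a] \<boxtimes> \<one>[b]) \<cdot> \<a>[\<I>, \<I> \<otimes> a, b] \<cdot> (\<one>[\<I>] \<boxtimes> \<a>[\<I>, a, b])"
    using pentagon [of \<I> \<I> a b] a b by simp
  also have "\<dots> = ((\<one>[\<I>] \<boxtimes> \<l>[a]) \<boxtimes> \<one>[b]) \<cdot> \<a>[\<I>, \<I> \<otimes> a, b] \<cdot> (\<one>[\<I>] \<boxtimes> \<a>[\<I>, a, b])"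
    using triangle [of \<I> a] a b by (simp add: interchange_extend)
  also have "\<dots> = \<a>[\<I>, a, b] \<cdot> (\<one>[\<I>] \<boxtimes> (\<l>[a] \<boxtimes> \<one>[b])) \<cdot> (\<one>[\<I>] \<boxtimes> \<a>[\<I>, a, b])"
    using Comp_eq_extend [OF Associator_nat [of "\<one>[\<I>]" "\<l>[a]" "\<one>[b]"], of "\<one>[\<I>] \<boxtimes> \<a>[\<I>, a, b]"] a b
    by simp
  also have "\<dots> = \<a>[\<I>, a, b] \<cdot> (\<one>[\<I>] \<boxtimes> ((\<l>[a] \<boxtimes> \<one>[b]) \<cdot> \<a>[\<I>, a, b]))"
    using a b by (simp add: merge)
  finally show "\<one>[\<I>] \<boxtimes> \<l>[a \<otimes> b] = \<one>[\<I>] \<boxtimes> ((\<l>[a] \<boxtimes> \<one>[b]) \<cdot> \<a>[\<I>, a, b])"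
    using a b by - (rule iso_cancel_left [OF Associator_iso [of \<I> a b]], simp_all)
qed (use a b in simp_all)

text \<open>As the right unitor is \<open>\<l>[a] \<cdot> \<s>[a, \<I>]\<close>, the hexagon at a unit reduces its compatibility
  with the tensor product to that of the left unitor and the triangle.\<close>

lemma Right_unitor_Tensor:
  assumes a: "a \<in> Obj C" and b: "b \<in> Obj C"
  shows "(\<l>[a \<otimes> b] \<cdot> \<s>[a \<otimes> b, \<I>]) \<cdot> \<a>[a, b, \<I>] = \<one>[a] \<boxtimes> (\<l>[b] \<cdot> \<s>[b, \<I>])"
proof -
  have "(\<l>[a \<otimes> b] \<cdot> \<s>[a \<otimes> b, \<I>]) \<cdot> \<a>[a, b, \<I>]
    = (\<l>[a] \<boxtimes> \<one>[b]) \<cdot> \<a>[\<I>, a, b] \<cdot> \<s>[a \<otimes> b, \<I>] \<cdot> \<a>[a, b, \<I>]"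
    using a b by (simp flip: Left_unitor_Tensor)
  also have "\<dots> = (\<l>[a] \<boxtimes> \<one>[b]) \<cdot> (\<s>[a, \<I>] \<boxtimes> \<one>[b]) \<cdot> \<a>[a, \<I>, b] \<cdot> (\<one>[a] \<boxtimes> \<s>[b, \<I>])"
    using a b by (simp add: hexagon)
  also have "\<dots> = (((\<l>[a] \<cdot> \<s>[a, \<I>]) \<boxtimes> \<one>[b]) \<cdot> \<a>[a, \<I>, b]) \<cdot> (\<one>[a] \<boxtimes> \<s>[b, \<I>])"
    using a b by (simp add: merge)
  also have "\<dots> = (\<one>[a] \<boxtimes> \<l>[b]) \<cdot> (\<one>[a] \<boxtimes> \<s>[b, \<I>])"
    using a b by (simp only: triangle)
  also have "\<dots> = \<one>[a] \<boxtimes> (\<l>[b] \<cdot> \<s>[b, \<I>])"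
    using a b by (simp add: merge)
  finally show ?thesis .
qed

text \<open>
  Both sides move the factor \<open>b\<close> of \<open>(b \<otimes> c) \<otimes> a\<close> to the end. One hexagon rewrites the
  first symmetry on the left, another one the second, and the two symmetries of \<open>a\<close> and \<open>c\<close>
  cancel. Conjugating a snake by symmetries produces the left-hand side.
\<close>

lemma Symmetry_hexagon_pair:
  assumes a: "a \<in> Obj C" and b: "b \<in> Obj C" and c: "c \<in> Obj C"
  shows "\<s>[a \<otimes> b, c] \<cdot> \<a>[a, b, c] \<cdot> \<s>[b \<otimes> c, a]
    = (\<one>[c] \<boxtimes> \<s>[b, a]) \<cdot> inv_arr C \<a>[c, b, a] \<cdot> (\<s>[b, c] \<boxtimes> \<one>[a])"
proof (rule iso_cancel_left [OF Associator_iso [of c a b]])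
  have "\<a>[c, a, b] \<cdot> \<s>[a \<otimes> b, c] \<cdot> \<a>[a, b, c] \<cdot> \<s>[b \<otimes> c, a]
    = (\<a>[c, a, b] \<cdot> \<s>[a \<otimes> b, c] \<cdot> \<a>[a, b, c]) \<cdot> \<s>[b \<otimes> c, a]"
    using a b c by simp
  also have "\<dots> = (\<s>[a, c] \<boxtimes> \<one>[b]) \<cdot> \<a>[a, c, b] \<cdot> (\<one>[a] \<boxtimes> \<s>[b, c]) \<cdot> \<s>[b \<otimes> c, a]"
    using a b c by (simp add: hexagon)
  also have "\<dots> = (\<s>[a, c] \<boxtimes> \<one>[b]) \<cdot> \<a>[a, c, b] \<cdot> \<s>[c \<otimes> b, a] \<cdot> (\<s>[b, c] \<boxtimes> \<one>[a])"
    using Symmetry_nat [of "\<s>[b, c]" "\<one>[a]"] a b c by simp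
  also have "\<dots> = (\<s>[a, c] \<boxtimes> \<one>[b]) \<cdot> (\<a>[a, c, b] \<cdot> \<s>[c \<otimes> b, a] \<cdot> \<a>[c, b, a])
      \<cdot> inv_arr C \<a>[c, b, a] \<cdot> (\<s>[b, c] \<boxtimes> \<one>[a])"
    using a b c by simp
  also have "\<dots> = (\<s>[a, c] \<boxtimes> \<one>[b]) \<cdot> (\<s>[c, a] \<boxtimes> \<one>[b]) \<cdot> \<a>[c, a, b] \<cdot> (\<one>[c] \<boxtimes> \<s>[b, a])
      \<cdot> inv_arr C \<a>[c, b, a] \<cdot> (\<s>[b, c] \<boxtimes> \<one>[a])"
    unfolding hexagon [OF c b a] using a b c by simp
  also have "\<dots> = \<a>[c, a, b] \<cdot> (\<one>[c] \<boxtimes> \<s>[b, a]) \<cdot> inv_arr C \<a>[c, b, a] \<cdot> (\<s>[b, c] \<boxtimes> \<one>[a])"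
    using a b c by (simp add: interchange_extend)
  finally show "\<a>[c, a, b] \<cdot> \<s>[a \<otimes> b, c] \<cdot> \<a>[a, b, c] \<cdot> \<s>[b \<otimes> c, a]
    = \<a>[c, a, b] \<cdot> (\<one>[c] \<boxtimes> \<s>[b, a]) \<cdot> inv_arr C \<a>[c, b, a] \<cdot> (\<s>[b, c] \<boxtimes> \<one>[a])" .
qed (use a b c in simp_all)

end

section \<open>Straightening wires in compact closed categories\<close>

context compact_closed_category
begin

declare Dual_Obj [simp]

lemma Eta_type [simp]:
  assumes "a \<in> Obj C"
  shows "\<eta>[a] \<in> Arr C" "Dom C \<eta>[a] = \<I>" "Cod C \<eta>[a] = a\<^sup>\<star> \<otimes> a"
  using Eta_Hom [OF assms] by (auto simp: Hom_iff)

lemma Eps_type [simp]: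
  assumes "a \<in> Obj C"
  shows "\<epsilon>[a] \<in> Arr C" "Dom C \<epsilon>[a] = a \<otimes> a\<^sup>\<star>" "Cod C \<epsilon>[a] = \<I>"
  using Eps_Hom [OF assms] by (auto simp: Hom_iff)

lemma name_type [simp]:
  assumes "f \<in> Arr C"
  shows "\<ulcorner>f\<urcorner> \<in> Arr C" "Dom C \<ulcorner>f\<urcorner> = \<I>" "Cod C \<ulcorner>f\<urcorner> = (Dom C f)\<^sup>\<star> \<otimes> Cod C f"
  using assms by (simp_all add: name_def)

lemma coname_type [simp]:
  assumes "f \<in> Arr C"
  shows "\<llcorner>f\<lrcorner> \<in> Arr C" "Dom C \<llcorner>f\<lrcorner> = Dom C f \<otimes> (Cod C f)\<^sup>\<star>" "Cod C \<llcorner>f\<lrcorner> = \<I>"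
  using assms by (simp_all add: coname_def)

lemma upper_star_type [simp]:
  assumes "f \<in> Arr C"
  shows "upper_star C f \<in> Arr C" "Dom C (upper_star C f) = (Cod C f)\<^sup>\<star>"
    "Cod C (upper_star C f) = (Dom C f)\<^sup>\<star>"
  using assms by (simp_all add: upper_star_def Let_def)

lemma double_dual_type [simp]:
  assumes "a \<in> Obj C"
  shows "\<w>[a] \<in> Arr C" "Dom C \<w>[a] = (a\<^sup>\<star>)\<^sup>\<star>" "Cod C \<w>[a] = a"
  using assms by (simp_all add: double_dual_def)

text \<open>
  Contracting the second leg of a bipartite state with the first leg of \<open>\<eta>[b]\<close>: the state is
  moved before \<open>\<eta>[b]\<close> by interchange, and then the snake equation for \<open>b\<close> applies inside
  \<open>x \<otimes> _\<close>.
\<close>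

lemma state_Tensor_Eta:
  assumes x: "x \<in> Obj C" and b: "b \<in> Obj C"
    and n: "n \<in> Arr C" "Dom C n = \<I>" "Cod C n = x \<otimes> b"
  shows "(\<one>[x] \<boxtimes> (\<epsilon>[b] \<boxtimes> \<one>[b])) \<cdot> (\<one>[x] \<boxtimes> \<a>[b, b\<^sup>\<star>, b]) \<cdot> inv_arr C \<a>[x, b, b\<^sup>\<star> \<otimes> b] \<cdot> (n \<boxtimes> \<eta>[b])
    = (\<one>[x] \<boxtimes> \<s>[b, \<I>]) \<cdot> inv_arr C \<a>[x, b, \<I>] \<cdot> (n \<boxtimes> \<one>[\<I>])" (is "?L = _")
proof -
  have "inv_arr C \<a>[x, b, b\<^sup>\<star> \<otimes> b] \<cdot> (n \<boxtimes> \<eta>[b])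
    = inv_arr C \<a>[x, b, b\<^sup>\<star> \<otimes> b] \<cdot> ((\<one>[x] \<boxtimes> \<one>[b]) \<boxtimes> \<eta>[b]) \<cdot> (n \<boxtimes> \<one>[\<I>])"
    using x b n by (simp add: interchange)
  also have "\<dots> = (\<one>[x] \<boxtimes> (\<one>[b] \<boxtimes> \<eta>[b])) \<cdot> inv_arr C \<a>[x, b, \<I>] \<cdot> (n \<boxtimes> \<one>[\<I>])"
    using Comp_eq_extend [OF Associator_inv_nat [of "\<one>[x]" "\<one>[b]" "\<eta>[b]"], of "n \<boxtimes> \<one>[\<I>]"] x b n
    by simp
  finally have "?L = (\<one>[x] \<boxtimes> ((\<epsilon>[b] \<boxtimes> \<one>[b]) \<cdot> \<a>[b, b\<^sup>\<star>, b] \<cdot> (\<one>[b] \<boxtimes> \<eta>[b])))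
      \<cdot> inv_arr C \<a>[x, b, \<I>] \<cdot> (n \<boxtimes> \<one>[\<I>])"
    using x b n by (simp add: interchange_extend)
  then show ?thesis using snake [OF b] by simp
qed

text \<open>
  The same contraction with its unit object removed returns the state. The symmetry that the
  snake equation leaves behind combines with \<open>\<l>\<close> to a right unitor, which passes through the
  state to \<open>\<I> \<otimes> \<I>\<close>; there the two unitors agree. This is both the step in which entanglement
  is transferred and the reason why transposes slide around \<open>\<eta>\<close>.
\<close>

lemma yank:
  assumes x: "x \<in> Obj C" and b: "b \<in> Obj C"
    and n: "n \<in> Arr C" "Dom C n = \<I>" "Cod C n = x \<otimes> b"
  shows "(\<one>[x] \<boxtimes> \<l>[b]) \<cdot> (\<one>[x] \<boxtimes> (\<epsilon>[b] \<boxtimes> \<one>[b])) \<cdot> (\<one>[x] \<boxtimes> \<a>[b, b\<^sup>\<star>, b])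
    \<cdot> inv_arr C \<a>[x, b, b\<^sup>\<star> \<otimes> b] \<cdot> (n \<boxtimes> \<eta>[b]) = n \<cdot> \<l>[\<I>]" (is "?L = _")
proof -
  have "?L = (\<one>[x] \<boxtimes> (\<l>[b] \<cdot> \<s>[b, \<I>])) \<cdot> inv_arr C \<a>[x, b, \<I>] \<cdot> (n \<boxtimes> \<one>[\<I>])"
    unfolding state_Tensor_Eta [OF assms] using x b n by (simp add: interchange_extend)
  also have "\<dots> = \<l>[x \<otimes> b] \<cdot> \<s>[x \<otimes> b, \<I>] \<cdot> (n \<boxtimes> \<one>[\<I>])"
    unfolding Right_unitor_Tensor [OF x b, symmetric] using x b n by simp
  also have "\<dots> = \<l>[x \<otimes> b] \<cdot> (\<one>[\<I>] \<boxtimes> n) \<cdot> \<s>[\<I>, \<I>]"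
    using Symmetry_nat [of n "\<one>[\<I>]"] n by simp
  also have "\<dots> = n \<cdot> \<l>[\<I>] \<cdot> \<s>[\<I>, \<I>]"
    using Comp_eq_extend [OF Left_unitor_nat [of n], of "\<s>[\<I>, \<I>]"] n x b by simp
  finally show ?thesis by (simp add: unitors_Unit)
qed

text \<open>
  The transpose contracts \<open>\<ulcorner>f\<urcorner>\<close> with its input, so applying it to the first leg of \<open>\<eta>\<close> contracts
  the second leg of \<open>\<ulcorner>f\<urcorner>\<close> with that leg. The pentagon brings this to the form in which \<open>yank\<close>
  applies.
\<close>

lemma upper_star_Eta:
  assumes f: "f \<in> Arr C"
  shows "(upper_star C f \<boxtimes> \<one>[Cod C f]) \<cdot> \<eta>[Cod C f] = \<ulcorner>f\<urcorner>"
proof -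
  define a b n where "a = Dom C f" and "b = Cod C f" and "n = \<ulcorner>f\<urcorner>"
  have o: "a \<in> Obj C" "b \<in> Obj C" using f by (simp_all add: a_def b_def)
  have n: "n \<in> Arr C" "Dom C n = \<I>" "Cod C n = a\<^sup>\<star> \<otimes> b" using f by (simp_all add: a_def b_def n_def)
  have star: "upper_star C f = (\<l>[a\<^sup>\<star>] \<cdot> \<s>[a\<^sup>\<star>, \<I>]) \<cdot> (\<one>[a\<^sup>\<star>] \<boxtimes> \<epsilon>[b])
      \<cdot> inv_arr C \<a>[a\<^sup>\<star>, b, b\<^sup>\<star>] \<cdot> (n \<boxtimes> \<one>[b\<^sup>\<star>]) \<cdot> inv_arr C \<l>[b\<^sup>\<star>]"
    using f by (simp add: upper_star_def name_def Let_def a_def b_def n_def interchange_extend)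
  have unit: "(inv_arr C \<l>[b\<^sup>\<star>] \<boxtimes> \<one>[b]) \<cdot> \<eta>[b] = \<a>[\<I>, b\<^sup>\<star>, b] \<cdot> (\<one>[\<I>] \<boxtimes> \<eta>[b]) \<cdot> inv_arr C \<l>[\<I>]"
  proof -
    have "\<a>[\<I>, b\<^sup>\<star>, b] \<cdot> (\<one>[\<I>] \<boxtimes> \<eta>[b]) \<cdot> inv_arr C \<l>[\<I>]
      = (inv_arr C \<l>[b\<^sup>\<star>] \<boxtimes> \<one>[b]) \<cdot> ((\<l>[b\<^sup>\<star>] \<boxtimes> \<one>[b]) \<cdot> \<a>[\<I>, b\<^sup>\<star>, b]) \<cdot> (\<one>[\<I>] \<boxtimes> \<eta>[b]) \<cdot> inv_arr C \<l>[\<I>]"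
      using o by (simp add: interchange_extend)
    also have "\<dots> = (inv_arr C \<l>[b\<^sup>\<star>] \<boxtimes> \<one>[b]) \<cdot> \<l>[b\<^sup>\<star> \<otimes> b] \<cdot> (\<one>[\<I>] \<boxtimes> \<eta>[b]) \<cdot> inv_arr C \<l>[\<I>]"
      using o by (simp only: Left_unitor_Tensor Dual_Obj)
    also have "\<dots> = (inv_arr C \<l>[b\<^sup>\<star>] \<boxtimes> \<one>[b]) \<cdot> \<eta>[b]"
      using Left_unitor_inv_nat [of "\<eta>[b]", symmetric] o by simp
    finally show ?thesis by simp
  qed
  have pent: "(inv_arr C \<a>[a\<^sup>\<star>, b, b\<^sup>\<star>] \<boxtimes> \<one>[b]) \<cdot> \<a>[a\<^sup>\<star> \<otimes> b, b\<^sup>\<star>, b]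
    = \<a>[a\<^sup>\<star>, b \<otimes> b\<^sup>\<star>, b] \<cdot> (\<one>[a\<^sup>\<star>] \<boxtimes> \<a>[b, b\<^sup>\<star>, b]) \<cdot> inv_arr C \<a>[a\<^sup>\<star>, b, b\<^sup>\<star> \<otimes> b]"
    using o by (intro pentagon_inv) simp_all
  have "(upper_star C f \<boxtimes> \<one>[b]) \<cdot> \<eta>[b]
    = ((\<l>[a\<^sup>\<star>] \<cdot> \<s>[a\<^sup>\<star>, \<I>]) \<boxtimes> \<one>[b]) \<cdot> ((\<one>[a\<^sup>\<star>] \<boxtimes> \<epsilon>[b]) \<boxtimes> \<one>[b])
      \<cdot> (inv_arr C \<a>[a\<^sup>\<star>, b, b\<^sup>\<star>] \<boxtimes> \<one>[b]) \<cdot> ((n \<boxtimes> \<one>[b\<^sup>\<star>]) \<boxtimes> \<one>[b]) \<cdot> (inv_arr C \<l>[b\<^sup>\<star>] \<boxtimes> \<one>[b]) \<cdot> \<eta>[b]"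
    using o n unfolding star by (simp add: interchange_extend)
  also have "\<dots> = ((\<l>[a\<^sup>\<star>] \<cdot> \<s>[a\<^sup>\<star>, \<I>]) \<boxtimes> \<one>[b]) \<cdot> ((\<one>[a\<^sup>\<star>] \<boxtimes> \<epsilon>[b]) \<boxtimes> \<one>[b])
      \<cdot> (inv_arr C \<a>[a\<^sup>\<star>, b, b\<^sup>\<star>] \<boxtimes> \<one>[b]) \<cdot> ((n \<boxtimes> \<one>[b\<^sup>\<star>]) \<boxtimes> \<one>[b]) \<cdot> \<a>[\<I>, b\<^sup>\<star>, b]
      \<cdot> (\<one>[\<I>] \<boxtimes> \<eta>[b]) \<cdot> inv_arr C \<l>[\<I>]"
    unfolding unit ..
  also have "\<dots> = ((\<l>[a\<^sup>\<star>] \<cdot> \<s>[a\<^sup>\<star>, \<I>]) \<boxtimes> \<one>[b]) \<cdot> ((\<one>[a\<^sup>\<star>] \<boxtimes> \<epsilon>[b]) \<boxtimes> \<one>[b])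
      \<cdot> ((inv_arr C \<a>[a\<^sup>\<star>, b, b\<^sup>\<star>] \<boxtimes> \<one>[b]) \<cdot> \<a>[a\<^sup>\<star> \<otimes> b, b\<^sup>\<star>, b]) \<cdot> (n \<boxtimes> \<eta>[b]) \<cdot> inv_arr C \<l>[\<I>]"
    using Comp_eq_extend [OF Associator_nat [of n "\<one>[b\<^sup>\<star>]" "\<one>[b]"],
        of "(\<one>[\<I>] \<boxtimes> \<eta>[b]) \<cdot> inv_arr C \<l>[\<I>]", symmetric] o n by (simp add: interchange_extend)
  also have "\<dots> = ((\<l>[a\<^sup>\<star>] \<cdot> \<s>[a\<^sup>\<star>, \<I>]) \<boxtimes> \<one>[b]) \<cdot> ((\<one>[a\<^sup>\<star>] \<boxtimes> \<epsilon>[b]) \<boxtimes> \<one>[b])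
      \<cdot> \<a>[a\<^sup>\<star>, b \<otimes> b\<^sup>\<star>, b] \<cdot> (\<one>[a\<^sup>\<star>] \<boxtimes> \<a>[b, b\<^sup>\<star>, b]) \<cdot> inv_arr C \<a>[a\<^sup>\<star>, b, b\<^sup>\<star> \<otimes> b]
      \<cdot> (n \<boxtimes> \<eta>[b]) \<cdot> inv_arr C \<l>[\<I>]"
    unfolding pent using o n by simp
  also have "\<dots> = (((\<l>[a\<^sup>\<star>] \<cdot> \<s>[a\<^sup>\<star>, \<I>]) \<boxtimes> \<one>[b]) \<cdot> \<a>[a\<^sup>\<star>, \<I>, b]) \<cdot> (\<one>[a\<^sup>\<star>] \<boxtimes> (\<epsilon>[b] \<boxtimes> \<one>[b]))
      \<cdot> (\<one>[a\<^sup>\<star>] \<boxtimes> \<a>[b, b\<^sup>\<star>, b]) \<cdot> inv_arr C \<a>[a\<^sup>\<star>, b, b\<^sup>\<star> \<otimes> b] \<cdot> (n \<boxtimes> \<eta>[b]) \<cdot> inv_arr C \<l>[\<I>]"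
    using Comp_eq_extend [OF Associator_nat [of "\<one>[a\<^sup>\<star>]" "\<epsilon>[b]" "\<one>[b]"],
        of "(\<one>[a\<^sup>\<star>] \<boxtimes> \<a>[b, b\<^sup>\<star>, b]) \<cdot> inv_arr C \<a>[a\<^sup>\<star>, b, b\<^sup>\<star> \<otimes> b] \<cdot> (n \<boxtimes> \<eta>[b]) \<cdot> inv_arr C \<l>[\<I>]",
        symmetric] o n by simp
  also have "\<dots> = ((\<one>[a\<^sup>\<star>] \<boxtimes> \<l>[b]) \<cdot> (\<one>[a\<^sup>\<star>] \<boxtimes> (\<epsilon>[b] \<boxtimes> \<one>[b]))
      \<cdot> (\<one>[a\<^sup>\<star>] \<boxtimes> \<a>[b, b\<^sup>\<star>, b]) \<cdot> inv_arr C \<a>[a\<^sup>\<star>, b, b\<^sup>\<star> \<otimes> b] \<cdot> (n \<boxtimes> \<eta>[b])) \<cdot> inv_arr C \<l>[\<I>]"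
    unfolding triangle [OF Dual_Obj [OF o(1)] o(2)] using o n by simp
  also have "\<dots> = n"
    unfolding yank [OF Dual_Obj [OF o(1)] o(2) n] using n by simp
  finally show ?thesis by (simp add: b_def n_def)
qed

text \<open>
  Exchanging the legs of both \<open>\<eta>[a]\<close> and \<open>\<epsilon>[a]\<close> makes \<open>a\<^sup>\<star>\<close> a dual on the other side. The
  corresponding snake is the given one conjugated by symmetries.
\<close>

lemma snake_mirror:
  assumes a: "a \<in> Obj C"
  shows "(\<one>[a] \<boxtimes> (\<epsilon>[a] \<cdot> \<s>[a\<^sup>\<star>, a])) \<cdot> inv_arr C \<a>[a, a\<^sup>\<star>, a] \<cdot> ((\<s>[a\<^sup>\<star>, a] \<cdot> \<eta>[a]) \<boxtimes> \<one>[a]) = \<s>[\<I>, a]"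
    (is "?L = _")
proof -
  have "?L = (\<one>[a] \<boxtimes> \<epsilon>[a]) \<cdot> ((\<one>[a] \<boxtimes> \<s>[a\<^sup>\<star>, a]) \<cdot> inv_arr C \<a>[a, a\<^sup>\<star>, a] \<cdot> (\<s>[a\<^sup>\<star>, a] \<boxtimes> \<one>[a])) \<cdot> (\<eta>[a] \<boxtimes> \<one>[a])"
    using a by (simp add: merge)
  also have "\<dots> = (\<one>[a] \<boxtimes> \<epsilon>[a]) \<cdot> \<s>[a \<otimes> a\<^sup>\<star>, a] \<cdot> \<a>[a, a\<^sup>\<star>, a] \<cdot> \<s>[a\<^sup>\<star> \<otimes> a, a] \<cdot> (\<eta>[a] \<boxtimes> \<one>[a])"
    unfolding Symmetry_hexagon_pair [OF a Dual_Obj [OF a] a, symmetric] using a by simp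
  also have "\<dots> = (\<one>[a] \<boxtimes> \<epsilon>[a]) \<cdot> \<s>[a \<otimes> a\<^sup>\<star>, a] \<cdot> \<a>[a, a\<^sup>\<star>, a] \<cdot> (\<one>[a] \<boxtimes> \<eta>[a]) \<cdot> \<s>[\<I>, a]"
    using Symmetry_nat [of "\<eta>[a]" "\<one>[a]"] a by simp
  also have "\<dots> = \<s>[\<I>, a] \<cdot> ((\<epsilon>[a] \<boxtimes> \<one>[a]) \<cdot> \<a>[a, a\<^sup>\<star>, a] \<cdot> (\<one>[a] \<boxtimes> \<eta>[a])) \<cdot> \<s>[\<I>, a]"
    using Comp_eq_extend [OF Symmetry_nat [of "\<epsilon>[a]" "\<one>[a]"],
        of "\<a>[a, a\<^sup>\<star>, a] \<cdot> (\<one>[a] \<boxtimes> \<eta>[a]) \<cdot> \<s>[\<I>, a]"] a by simp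
  also have "\<dots> = \<s>[\<I>, a]"
    unfolding snake [OF a] using a by simp
  finally show ?thesis .
qed

text \<open>
  The arrow \<open>\<w>[Q]\<close> is itself a bent wire: it creates \<open>\<eta>[Q]\<close> and contracts its input with the
  \<open>Q\<^sup>\<star>\<close> leg. Applied to the unit of \<open>Q\<^sup>\<star>\<close>, this forms a mirrored snake on the wire \<open>Q\<^sup>\<star>\<close>, and
  only \<open>\<eta>[Q]\<close> is left once it is straightened.
\<close>

lemma double_dual_Eta:
  assumes Q: "Q \<in> Obj C"
  shows "(\<one>[Q\<^sup>\<star>] \<boxtimes> \<w>[Q]) \<cdot> \<s>[(Q\<^sup>\<star>)\<^sup>\<star>, Q\<^sup>\<star>] \<cdot> \<eta>[Q\<^sup>\<star>] = \<eta>[Q]"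
proof -
  define A B where "A = Q\<^sup>\<star>" and "B = (Q\<^sup>\<star>)\<^sup>\<star>"
  define \<theta> e where "\<theta> = \<s>[B, A] \<cdot> \<eta>[A]" and "e = \<epsilon>[A] \<cdot> \<s>[B, A]"
  have o: "A \<in> Obj C" "B \<in> Obj C" "Q \<in> Obj C" "A\<^sup>\<star> = B" "Q\<^sup>\<star> = A" using Q by (simp_all add: A_def B_def)
  have t: "\<theta> \<in> Arr C" "Dom C \<theta> = \<I>" "Cod C \<theta> = A \<otimes> B"
    "e \<in> Arr C" "Dom C e = B \<otimes> A" "Cod C e = \<I>" using o by (simp_all add: \<theta>_def e_def)
  have eta: "\<eta>[Q] \<in> Arr C" "Dom C \<eta>[Q] = \<I>" "Cod C \<eta>[Q] = A \<otimes> Q" using o by simp_all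
  have w: "\<w>[Q] = \<l>[Q] \<cdot> (e \<boxtimes> \<one>[Q]) \<cdot> \<a>[B, A, Q] \<cdot> (\<one>[B] \<boxtimes> \<eta>[Q]) \<cdot> \<s>[\<I>, B] \<cdot> inv_arr C \<l>[B]"
    using o unfolding double_dual_def e_def by (simp add: interchange_extend)
  \<comment> \<open>Here \<open>\<s>[\<I>, B] \<cdot> inv_arr C \<l>[B]\<close> is the inverse of the right unitor of \<open>B\<close>, which by
    \<open>Right_unitor_Tensor\<close> may be introduced before the state instead of on its second leg.\<close>
  have runit: "(\<one>[A] \<boxtimes> (\<s>[\<I>, B] \<cdot> inv_arr C \<l>[B])) \<cdot> \<theta>
    = inv_arr C \<a>[A, B, \<I>] \<cdot> (\<theta> \<boxtimes> \<one>[\<I>]) \<cdot> inv_arr C \<l>[\<I>]" (is "?L = ?R")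
  proof -
    have "(\<one>[A] \<boxtimes> (\<l>[B] \<cdot> \<s>[B, \<I>])) \<cdot> ?R = \<l>[A \<otimes> B] \<cdot> \<s>[A \<otimes> B, \<I>] \<cdot> (\<theta> \<boxtimes> \<one>[\<I>]) \<cdot> inv_arr C \<l>[\<I>]"
      using o t by (simp flip: Right_unitor_Tensor)
    also have "\<dots> = \<l>[A \<otimes> B] \<cdot> (\<one>[\<I>] \<boxtimes> \<theta>) \<cdot> \<s>[\<I>, \<I>] \<cdot> inv_arr C \<l>[\<I>]"
      using Comp_eq_extend [OF Symmetry_nat [of \<theta> "\<one>[\<I>]"], of "inv_arr C \<l>[\<I>]"] o t by simp
    also have "\<dots> = \<theta> \<cdot> (\<l>[\<I>] \<cdot> \<s>[\<I>, \<I>]) \<cdot> inv_arr C \<l>[\<I>]"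
      using Comp_eq_extend [OF Left_unitor_nat [of \<theta>], of "\<s>[\<I>, \<I>] \<cdot> inv_arr C \<l>[\<I>]"] o t by simp
    also have "\<dots> = \<theta>"
      unfolding unitors_Unit using t by simp
    finally have "?L = (\<one>[A] \<boxtimes> (\<s>[\<I>, B] \<cdot> inv_arr C \<l>[B])) \<cdot> (\<one>[A] \<boxtimes> (\<l>[B] \<cdot> \<s>[B, \<I>])) \<cdot> ?R"
      by simp
    also have "\<dots> = ?R"
      using o t by (simp add: interchange_extend)
    finally show ?thesis .
  qed
  have pent: "(\<one>[A] \<boxtimes> \<a>[B, A, Q]) \<cdot> inv_arr C \<a>[A, B, A \<otimes> Q]
    = inv_arr C \<a>[A, B \<otimes> A, Q] \<cdot> (inv_arr C \<a>[A, B, A] \<boxtimes> \<one>[Q]) \<cdot> \<a>[A \<otimes> B, A, Q]"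
    using pentagon_inv [of A B A Q] o by simp
  have "(\<one>[A] \<boxtimes> \<w>[Q]) \<cdot> \<theta> = (\<one>[A] \<boxtimes> \<l>[Q]) \<cdot> (\<one>[A] \<boxtimes> (e \<boxtimes> \<one>[Q])) \<cdot> (\<one>[A] \<boxtimes> \<a>[B, A, Q])
      \<cdot> (\<one>[A] \<boxtimes> (\<one>[B] \<boxtimes> \<eta>[Q])) \<cdot> (\<one>[A] \<boxtimes> (\<s>[\<I>, B] \<cdot> inv_arr C \<l>[B])) \<cdot> \<theta>"
    unfolding w using o t eta by (simp add: interchange_extend)
  also have "\<dots> = (\<one>[A] \<boxtimes> \<l>[Q]) \<cdot> (\<one>[A] \<boxtimes> (e \<boxtimes> \<one>[Q])) \<cdot> (\<one>[A] \<boxtimes> \<a>[B, A, Q])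
      \<cdot> (\<one>[A] \<boxtimes> (\<one>[B] \<boxtimes> \<eta>[Q])) \<cdot> inv_arr C \<a>[A, B, \<I>] \<cdot> (\<theta> \<boxtimes> \<one>[\<I>]) \<cdot> inv_arr C \<l>[\<I>]"
    unfolding runit ..
  also have "\<dots> = (\<one>[A] \<boxtimes> \<l>[Q]) \<cdot> (\<one>[A] \<boxtimes> (e \<boxtimes> \<one>[Q])) \<cdot> ((\<one>[A] \<boxtimes> \<a>[B, A, Q])
      \<cdot> inv_arr C \<a>[A, B, A \<otimes> Q]) \<cdot> (\<theta> \<boxtimes> \<eta>[Q]) \<cdot> inv_arr C \<l>[\<I>]"
    using Comp_eq_extend [OF Associator_inv_nat [of "\<one>[A]" "\<one>[B]" "\<eta>[Q]"],
        of "(\<theta> \<boxtimes> \<one>[\<I>]) \<cdot> inv_arr C \<l>[\<I>]", symmetric] o t eta by (simp add: interchange_extend)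
  also have "\<dots> = (\<one>[A] \<boxtimes> \<l>[Q]) \<cdot> (\<one>[A] \<boxtimes> (e \<boxtimes> \<one>[Q])) \<cdot> inv_arr C \<a>[A, B \<otimes> A, Q]
      \<cdot> (inv_arr C \<a>[A, B, A] \<boxtimes> \<one>[Q]) \<cdot> \<a>[A \<otimes> B, A, Q]
      \<cdot> (\<theta> \<boxtimes> (\<one>[A] \<boxtimes> \<one>[Q])) \<cdot> (\<one>[\<I>] \<boxtimes> \<eta>[Q]) \<cdot> inv_arr C \<l>[\<I>]"
    unfolding pent using o t eta by (simp add: interchange_extend)
  also have "\<dots> = (\<one>[A] \<boxtimes> \<l>[Q]) \<cdot> (\<one>[A] \<boxtimes> (e \<boxtimes> \<one>[Q])) \<cdot> inv_arr C \<a>[A, B \<otimes> A, Q]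
      \<cdot> (inv_arr C \<a>[A, B, A] \<boxtimes> \<one>[Q]) \<cdot> ((\<theta> \<boxtimes> \<one>[A]) \<boxtimes> \<one>[Q]) \<cdot> \<a>[\<I>, A, Q]
      \<cdot> (\<one>[\<I>] \<boxtimes> \<eta>[Q]) \<cdot> inv_arr C \<l>[\<I>]"
    using Comp_eq_extend [OF Associator_nat [of \<theta> "\<one>[A]" "\<one>[Q]"],
        of "(\<one>[\<I>] \<boxtimes> \<eta>[Q]) \<cdot> inv_arr C \<l>[\<I>]"] o t eta by simp
  also have "\<dots> = (\<one>[A] \<boxtimes> \<l>[Q]) \<cdot> inv_arr C \<a>[A, \<I>, Q] \<cdot> ((\<one>[A] \<boxtimes> e) \<boxtimes> \<one>[Q])
      \<cdot> (inv_arr C \<a>[A, B, A] \<boxtimes> \<one>[Q]) \<cdot> ((\<theta> \<boxtimes> \<one>[A]) \<boxtimes> \<one>[Q]) \<cdot> \<a>[\<I>, A, Q]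
      \<cdot> (\<one>[\<I>] \<boxtimes> \<eta>[Q]) \<cdot> inv_arr C \<l>[\<I>]"
    using Comp_eq_extend [OF Associator_inv_nat [of "\<one>[A]" e "\<one>[Q]"],
        of "(inv_arr C \<a>[A, B, A] \<boxtimes> \<one>[Q]) \<cdot> ((\<theta> \<boxtimes> \<one>[A]) \<boxtimes> \<one>[Q]) \<cdot> \<a>[\<I>, A, Q]
      \<cdot> (\<one>[\<I>] \<boxtimes> \<eta>[Q]) \<cdot> inv_arr C \<l>[\<I>]", symmetric] o t eta by simp
  also have "\<dots> = (\<one>[A] \<boxtimes> \<l>[Q]) \<cdot> inv_arr C \<a>[A, \<I>, Q]
      \<cdot> (((\<one>[A] \<boxtimes> e) \<cdot> inv_arr C \<a>[A, B, A] \<cdot> (\<theta> \<boxtimes> \<one>[A])) \<boxtimes> \<one>[Q]) \<cdot> \<a>[\<I>, A, Q]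
      \<cdot> (\<one>[\<I>] \<boxtimes> \<eta>[Q]) \<cdot> inv_arr C \<l>[\<I>]"
    using o t eta by (simp add: interchange_extend)
  also have "\<dots> = (\<one>[A] \<boxtimes> \<l>[Q]) \<cdot> inv_arr C \<a>[A, \<I>, Q]
      \<cdot> (\<s>[\<I>, A] \<boxtimes> \<one>[Q]) \<cdot> \<a>[\<I>, A, Q] \<cdot> (\<one>[\<I>] \<boxtimes> \<eta>[Q]) \<cdot> inv_arr C \<l>[\<I>]"
    using snake_mirror [OF o(1)] o by (simp add: \<theta>_def e_def)
  also have "\<dots> = ((\<l>[A] \<boxtimes> \<one>[Q]) \<cdot> \<a>[\<I>, A, Q]) \<cdot> (\<one>[\<I>] \<boxtimes> \<eta>[Q]) \<cdot> inv_arr C \<l>[\<I>]"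
    unfolding triangle [OF o(1,3), symmetric] using o eta by (simp add: interchange_extend)
  also have "\<dots> = \<l>[A \<otimes> Q] \<cdot> (\<one>[\<I>] \<boxtimes> \<eta>[Q]) \<cdot> inv_arr C \<l>[\<I>]"
    unfolding Left_unitor_Tensor [OF o(1,3)] ..
  also have "\<dots> = \<eta>[Q]"
    using Left_unitor_inv_nat [of "\<eta>[Q]", symmetric] o eta by simp
  finally show ?thesis by (simp add: A_def B_def \<theta>_def)
qed

text \<open>
  A pair \<open>p\<close> that has just been created from the unit object passes everything by naturality, so
  the rearrangement of the four systems becomes one in which a unit takes the place of the pair.
  By the triangle and \<open>Left_unitor_Tensor\<close>, the latter just moves the unit to the front.
\<close>

lemma rearrangement:
  assumes A: "A \<in> Obj C" and Q: "Q \<in> Obj C"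
    and p: "p \<in> Arr C" "Dom C p = \<I>" "Cod C p = Q \<otimes> A"
  shows "(\<s>[Q, A] \<boxtimes> \<one>[A \<otimes> Q]) \<cdot> inv_arr C \<a>[Q \<otimes> A, A, Q]
        \<cdot> (\<s>[A, Q \<otimes> A] \<boxtimes> \<one>[Q]) \<cdot> \<a>[A, Q \<otimes> A, Q] \<cdot> (\<one>[A] \<boxtimes> (p \<boxtimes> \<one>[Q]))
    = ((\<s>[Q, A] \<cdot> p) \<boxtimes> \<one>[A \<otimes> Q]) \<cdot> inv_arr C \<l>[A \<otimes> Q] \<cdot> (\<one>[A] \<boxtimes> \<l>[Q])" (is "?L = _")
proof -
  have "?L = (\<s>[Q, A] \<boxtimes> \<one>[A \<otimes> Q]) \<cdot> inv_arr C \<a>[Q \<otimes> A, A, Q]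
        \<cdot> (\<s>[A, Q \<otimes> A] \<boxtimes> \<one>[Q]) \<cdot> ((\<one>[A] \<boxtimes> p) \<boxtimes> \<one>[Q]) \<cdot> \<a>[A, \<I>, Q]"
    using Associator_nat [of "\<one>[A]" p "\<one>[Q]"] A Q p by simp
  also have "\<dots> = (\<s>[Q, A] \<boxtimes> \<one>[A \<otimes> Q]) \<cdot> inv_arr C \<a>[Q \<otimes> A, A, Q]
        \<cdot> ((p \<boxtimes> \<one>[A]) \<boxtimes> \<one>[Q]) \<cdot> (\<s>[A, \<I>] \<boxtimes> \<one>[Q]) \<cdot> \<a>[A, \<I>, Q]"
    using Symmetry_nat [of "\<one>[A]" p] A Q p by (simp add: interchange_extend)
  also have "\<dots> = (\<s>[Q, A] \<boxtimes> \<one>[A \<otimes> Q]) \<cdot> (p \<boxtimes> \<one>[A \<otimes> Q])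
        \<cdot> inv_arr C \<a>[\<I>, A, Q] \<cdot> (\<s>[A, \<I>] \<boxtimes> \<one>[Q]) \<cdot> \<a>[A, \<I>, Q]"
    using Comp_eq_extend [OF Associator_inv_nat [of p "\<one>[A]" "\<one>[Q]"],
        of "(\<s>[A, \<I>] \<boxtimes> \<one>[Q]) \<cdot> \<a>[A, \<I>, Q]"] A Q p by simp
  also have "inv_arr C \<a>[\<I>, A, Q] \<cdot> (\<s>[A, \<I>] \<boxtimes> \<one>[Q]) \<cdot> \<a>[A, \<I>, Q]
    = inv_arr C \<l>[A \<otimes> Q] \<cdot> (\<one>[A] \<boxtimes> \<l>[Q])" (is "?M = _")
  proof (rule iso_cancel_left [OF Left_unitor_iso [of "A \<otimes> Q"]])
    have "\<l>[A \<otimes> Q] \<cdot> ?M = ((\<l>[A] \<cdot> \<s>[A, \<I>]) \<boxtimes> \<one>[Q]) \<cdot> \<a>[A, \<I>, Q]"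
      using A Q by (simp add: interchange_extend flip: Left_unitor_Tensor)
    also have "\<dots> = \<one>[A] \<boxtimes> \<l>[Q]"
      using A Q by (rule triangle)
    finally show "\<l>[A \<otimes> Q] \<cdot> ?M = \<l>[A \<otimes> Q] \<cdot> inv_arr C \<l>[A \<otimes> Q] \<cdot> (\<one>[A] \<boxtimes> \<l>[Q])"
      using A Q by simp
  qed (use A Q in simp_all)
  finally show ?thesis using A Q p by (simp add: interchange_extend)
qed

end

section \<open>One branch of entanglement swapping\<close>

context dagger_compact_closed_category
begin

lemma Dagger_type [simp]:
  assumes "f \<in> Arr C"
  shows "f\<^sup>\<dagger> \<in> Arr C" "Dom C (f\<^sup>\<dagger>) = Cod C f" "Cod C (f\<^sup>\<dagger>) = Dom C f"
  using Dagger_Hom [of f "Dom C f" "Cod C f"] assms by (auto simp: Hom_iff)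

lemma lower_star_type [simp]:
  assumes "f \<in> Arr C"
  shows "lower_star C f \<in> Arr C" "Dom C (lower_star C f) = (Dom C f)\<^sup>\<star>"
    "Cod C (lower_star C f) = (Cod C f)\<^sup>\<star>"
  using assms by (simp_all add: lower_star_def)

text \<open>
  The symmetry exchanges the legs of the unit of the dual object, after which \<open>\<w>[a]\<close> acts on the
  second leg and \<open>double_dual_Eta\<close> turns the whole into the unit of \<open>a\<close>. Sliding the transpose
  \<open>lower_star C f\<close> of \<open>f\<^sup>\<dagger>\<close> around this unit gives a name.
\<close>

lemma name_lower_star:
  assumes f: "f \<in> Arr C" and ab: "Dom C f = a" "Cod C f = b"
  shows "\<s>[a, b\<^sup>\<star>] \<cdot> (\<w>[a] \<boxtimes> \<one>[b\<^sup>\<star>]) \<cdot> \<ulcorner>lower_star C f\<urcorner> = \<ulcorner>f\<^sup>\<dagger>\<urcorner>"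
proof -
  have o: "a \<in> Obj C" "b \<in> Obj C" using f ab by auto
  let ?g = "lower_star C f"
  have "\<s>[a, b\<^sup>\<star>] \<cdot> (\<w>[a] \<boxtimes> \<one>[b\<^sup>\<star>]) \<cdot> \<ulcorner>?g\<urcorner>
    = \<s>[a, b\<^sup>\<star>] \<cdot> (\<w>[a] \<boxtimes> ?g) \<cdot> \<eta>[a\<^sup>\<star>]"
    using f ab o by (simp add: name_def interchange_extend)
  also have "\<dots> = (?g \<boxtimes> \<w>[a]) \<cdot> \<s>[(a\<^sup>\<star>)\<^sup>\<star>, a\<^sup>\<star>] \<cdot> \<eta>[a\<^sup>\<star>]"
    using Comp_eq_extend [OF Symmetry_nat [of "\<w>[a]" ?g], of "\<eta>[a\<^sup>\<star>]"] f ab o by simp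
  also have "\<dots> = (?g \<boxtimes> \<one>[a]) \<cdot> (\<one>[a\<^sup>\<star>] \<boxtimes> \<w>[a]) \<cdot> \<s>[(a\<^sup>\<star>)\<^sup>\<star>, a\<^sup>\<star>] \<cdot> \<eta>[a\<^sup>\<star>]"
    using f ab o by (simp add: interchange_extend)
  also have "\<dots> = (?g \<boxtimes> \<one>[a]) \<cdot> \<eta>[a]"
    using o by (simp add: double_dual_Eta)
  also have "\<dots> = \<ulcorner>f\<^sup>\<dagger>\<urcorner>"
    using upper_star_Eta [of "f\<^sup>\<dagger>"] f ab by (simp add: lower_star_def)
  finally show ?thesis .
qed

text \<open>
  The correction acts with \<open>f\<close> on the pair that the measurement created, in the state
  \<open>\<ulcorner>f\<^sup>\<dagger>\<urcorner>\<close>, and with the inverse of \<open>f\<close> on the pair that it left entangled, in the state \<open>\<ulcorner>f\<urcorner>\<close>.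
  Unitarity is what makes both corrections cancel.
\<close>

lemma swapping_branch:
  assumes Q: "Q \<in> Obj C" and f: "f \<in> Arr C" "Dom C f = Q" "Cod C f = Q" and u: "unitary C f"
  shows "((\<one>[Q\<^sup>\<star>] \<boxtimes> f) \<boxtimes> (\<one>[Q\<^sup>\<star>] \<boxtimes> inv_arr C f))
      \<cdot> ((\<s>[Q, Q\<^sup>\<star>] \<boxtimes> \<one>[Q\<^sup>\<star> \<otimes> Q]) \<cdot> inv_arr C \<a>[Q \<otimes> Q\<^sup>\<star>, Q\<^sup>\<star>, Q]
        \<cdot> (\<s>[Q\<^sup>\<star>, Q \<otimes> Q\<^sup>\<star>] \<boxtimes> \<one>[Q]) \<cdot> \<a>[Q\<^sup>\<star>, Q \<otimes> Q\<^sup>\<star>, Q])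
      \<cdot> (\<one>[Q\<^sup>\<star>] \<boxtimes> (((\<w>[Q] \<boxtimes> \<one>[Q\<^sup>\<star>]) \<cdot> \<ulcorner>lower_star C f\<urcorner> \<cdot> \<llcorner>f\<lrcorner>) \<boxtimes> \<one>[Q]))
      \<cdot> (\<one>[Q\<^sup>\<star>] \<boxtimes> \<a>[Q, Q\<^sup>\<star>, Q]) \<cdot> inv_arr C \<a>[Q\<^sup>\<star>, Q, Q\<^sup>\<star> \<otimes> Q] \<cdot> (\<ulcorner>\<one>[Q]\<urcorner> \<boxtimes> \<ulcorner>\<one>[Q]\<urcorner>)
    = \<ulcorner>\<one>[Q]\<urcorner> \<boxtimes> \<ulcorner>\<one>[Q]\<urcorner>" (is "?Z \<cdot> ?R \<cdot> ?P \<cdot> ?rest = _")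
proof -
  define A where "A = Q\<^sup>\<star>"
  define p where "p = (\<w>[Q] \<boxtimes> \<one>[A]) \<cdot> \<ulcorner>lower_star C f\<urcorner>"
  define n where "n = \<ulcorner>f\<urcorner>"
  have o: "A \<in> Obj C" "Q \<in> Obj C" "Q\<^sup>\<star> = A" using Q by (simp_all add: A_def)
  have p: "p \<in> Arr C" "Dom C p = \<I>" "Cod C p = Q \<otimes> A" using o f by (simp_all add: p_def)
  have n: "n \<in> Arr C" "Dom C n = \<I>" "Cod C n = A \<otimes> Q" using o f by (simp_all add: n_def)
  have eta: "\<ulcorner>\<one>[Q]\<urcorner> = \<eta>[Q]" "\<eta>[Q] \<in> Arr C" "Dom C \<eta>[Q] = \<I>" "Cod C \<eta>[Q] = A \<otimes> Q"
    using o by (simp_all add: name_def)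
  have inv: "inv_arr C f = f\<^sup>\<dagger>" "f\<^sup>\<dagger> \<cdot> f = \<one>[Q]" "f \<cdot> f\<^sup>\<dagger> = \<one>[Q]"
    using u f inv_arr_eq [of f "f\<^sup>\<dagger>"] by (auto simp: unitary_def inverse_arrows_def Hom_iff)
  \<comment> \<open>The arrow \<open>f\<close> inside the coname is moved back onto the first Bell state, which becomes the
    state \<open>n\<close>; the effect that remains is \<open>\<epsilon>[Q]\<close>.\<close>
  have "?P \<cdot> ?rest = (\<one>[A] \<boxtimes> (p \<boxtimes> \<one>[Q])) \<cdot> (\<one>[A] \<boxtimes> (\<epsilon>[Q] \<boxtimes> \<one>[Q])) \<cdot> (\<one>[A] \<boxtimes> ((f \<boxtimes> \<one>[A]) \<boxtimes> \<one>[Q]))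
      \<cdot> (\<one>[A] \<boxtimes> \<a>[Q, A, Q]) \<cdot> inv_arr C \<a>[A, Q, A \<otimes> Q] \<cdot> (\<eta>[Q] \<boxtimes> \<eta>[Q])"
    unfolding eta(1) using o f p by (simp add: coname_def p_def interchange_extend)
  also have "(\<one>[A] \<boxtimes> ((f \<boxtimes> \<one>[A]) \<boxtimes> \<one>[Q])) \<cdot> (\<one>[A] \<boxtimes> \<a>[Q, A, Q]) \<cdot> inv_arr C \<a>[A, Q, A \<otimes> Q] \<cdot> (\<eta>[Q] \<boxtimes> \<eta>[Q])
    = (\<one>[A] \<boxtimes> \<a>[Q, A, Q]) \<cdot> (\<one>[A] \<boxtimes> (f \<boxtimes> \<one>[A \<otimes> Q])) \<cdot> inv_arr C \<a>[A, Q, A \<otimes> Q] \<cdot> (\<eta>[Q] \<boxtimes> \<eta>[Q])"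
    using Associator_nat [of f "\<one>[A]" "\<one>[Q]"] o f by (simp add: interchange_extend)
  also have "\<dots> = (\<one>[A] \<boxtimes> \<a>[Q, A, Q]) \<cdot> inv_arr C \<a>[A, Q, A \<otimes> Q] \<cdot> (n \<boxtimes> \<eta>[Q])"
    using Comp_eq_extend [OF Associator_inv_nat [of "\<one>[A]" f "\<one>[A \<otimes> Q]"], of "\<eta>[Q] \<boxtimes> \<eta>[Q]", symmetric] o f
    by (simp add: interchange n_def name_def)
  finally have proj: "?P \<cdot> ?rest = (\<one>[A] \<boxtimes> (p \<boxtimes> \<one>[Q])) \<cdot> (\<one>[A] \<boxtimes> (\<epsilon>[Q] \<boxtimes> \<one>[Q]))
      \<cdot> (\<one>[A] \<boxtimes> \<a>[Q, A, Q]) \<cdot> inv_arr C \<a>[A, Q, A \<otimes> Q] \<cdot> (n \<boxtimes> \<eta>[Q])" (is "_ = _ \<cdot> ?T") .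
  have T: "?T \<in> Arr C" "Dom C ?T = \<I> \<otimes> \<I>" "Cod C ?T = A \<otimes> (\<I> \<otimes> Q)"
    using o n eta by simp_all
  have yankT: "(\<one>[A] \<boxtimes> \<l>[Q]) \<cdot> ?T = n \<cdot> \<l>[\<I>]"
    using yank [OF o(1,2) n] o by simp
  have "?R \<cdot> ?P \<cdot> ?rest = ?R \<cdot> (\<one>[A] \<boxtimes> (p \<boxtimes> \<one>[Q])) \<cdot> ?T"
    unfolding proj ..
  also have "\<dots> = ((\<s>[Q, A] \<boxtimes> \<one>[A \<otimes> Q]) \<cdot> inv_arr C \<a>[Q \<otimes> A, A, Q]
        \<cdot> (\<s>[A, Q \<otimes> A] \<boxtimes> \<one>[Q]) \<cdot> \<a>[A, Q \<otimes> A, Q] \<cdot> (\<one>[A] \<boxtimes> (p \<boxtimes> \<one>[Q]))) \<cdot> ?T"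
    using o p n by simp
  also have "\<dots> = ((\<s>[Q, A] \<cdot> p) \<boxtimes> \<one>[A \<otimes> Q]) \<cdot> inv_arr C \<l>[A \<otimes> Q] \<cdot> (\<one>[A] \<boxtimes> \<l>[Q]) \<cdot> ?T"
    unfolding rearrangement [OF o(1,2) p] using o p n by simp
  also have "\<dots> = (\<ulcorner>f\<^sup>\<dagger>\<urcorner> \<boxtimes> \<one>[A \<otimes> Q]) \<cdot> inv_arr C \<l>[A \<otimes> Q] \<cdot> n \<cdot> \<l>[\<I>]"
    unfolding yankT using name_lower_star [OF f] by (simp add: p_def A_def)
  also have "\<dots> = (\<ulcorner>f\<^sup>\<dagger>\<urcorner> \<boxtimes> \<one>[A \<otimes> Q]) \<cdot> (\<one>[\<I>] \<boxtimes> n)"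
    using Comp_eq_extend [OF Left_unitor_inv_nat [of n], of "\<l>[\<I>]"] o f n by simp
  also have "\<dots> = \<ulcorner>f\<^sup>\<dagger>\<urcorner> \<boxtimes> n"
    using o f n by (simp add: interchange)
  finally have "?Z \<cdot> ?R \<cdot> ?P \<cdot> ?rest = ?Z \<cdot> (\<ulcorner>f\<^sup>\<dagger>\<urcorner> \<boxtimes> n)" by simp
  also have "\<dots> = \<eta>[Q] \<boxtimes> \<eta>[Q]"
    using o f inv(2,3) unfolding inv(1) by (simp add: n_def name_def merge)
  finally show ?thesis unfolding eta(1) .
qed

end

section \<open>Fourfold biproducts\<close>

context dagger_compact_closed_biproduct_category
begin

declare Biprod_Obj [simp]

lemma Proj_type [simp]:
  assumes "a \<in> Obj C" "b \<in> Obj C"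
  shows "\<p>\<^sub>1[a, b] \<in> Arr C" "Dom C \<p>\<^sub>1[a, b] = a \<oplus> b" "Cod C \<p>\<^sub>1[a, b] = a"
    "\<p>\<^sub>2[a, b] \<in> Arr C" "Dom C \<p>\<^sub>2[a, b] = a \<oplus> b" "Cod C \<p>\<^sub>2[a, b] = b"
  using Proj1_Hom [OF assms] Proj2_Hom [OF assms] by (auto simp: Hom_iff)

lemma pairing_props:
  assumes "f \<in> Arr C" "g \<in> Arr C" "Dom C f = Dom C g"
  shows "pairing C f g \<in> Hom C (Dom C g) (Cod C f \<oplus> Cod C g)
    \<and> \<p>\<^sub>1[Cod C f, Cod C g] \<cdot> pairing C f g = f \<and> \<p>\<^sub>2[Cod C f, Cod C g] \<cdot> pairing C f g = g"
proof -
  have "f \<in> Hom C (Dom C g) (Cod C f)" "g \<in> Hom C (Dom C g) (Cod C g)"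
    using assms by (simp_all add: Hom_iff)
  from theI' [OF Biprod_product [OF this]] show ?thesis
    unfolding pairing_def Let_def assms(3) .
qed

lemma pairing_type [simp]:
  assumes "f \<in> Arr C" "g \<in> Arr C" "Dom C f = Dom C g"
  shows "pairing C f g \<in> Arr C" "Dom C (pairing C f g) = Dom C g"
    "Cod C (pairing C f g) = Cod C f \<oplus> Cod C g"
  using pairing_props [OF assms] by (auto simp: Hom_iff)

lemma Proj_pairing [simp]:
  assumes "f \<in> Arr C" "g \<in> Arr C" "Dom C f = Dom C g" "Cod C f = a" "Cod C g = b"
  shows "\<p>\<^sub>1[a, b] \<cdot> pairing C f g = f" "\<p>\<^sub>2[a, b] \<cdot> pairing C f g = g"
  using pairing_props [OF assms(1-3)] assms by auto

lemma biprod_arr_type [simp]: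
  assumes "f \<in> Arr C" "g \<in> Arr C"
  shows "f \<boxplus> g \<in> Arr C" "Dom C (f \<boxplus> g) = Dom C f \<oplus> Dom C g" "Cod C (f \<boxplus> g) = Cod C f \<oplus> Cod C g"
  using assms by (simp_all add: biprod_arr_def)

lemma Proj_biprod_arr [simp]:
  assumes "f \<in> Arr C" "g \<in> Arr C" "Cod C f = a" "Cod C g = b"
  shows "\<p>\<^sub>1[a, b] \<cdot> (f \<boxplus> g) = f \<cdot> \<p>\<^sub>1[Dom C f, Dom C g]"
    "\<p>\<^sub>2[a, b] \<cdot> (f \<boxplus> g) = g \<cdot> \<p>\<^sub>2[Dom C f, Dom C g]"
  using assms by (simp_all add: biprod_arr_def)

lemma Proj_biprod_arr_extend [simp]:
  assumes "f \<in> Arr C" "g \<in> Arr C" "Cod C f = a" "Cod C g = b"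
    and "h \<in> Arr C" "Cod C h = Dom C f \<oplus> Dom C g"
  shows "\<p>\<^sub>1[a, b] \<cdot> (f \<boxplus> g) \<cdot> h = f \<cdot> \<p>\<^sub>1[Dom C f, Dom C g] \<cdot> h"
    "\<p>\<^sub>2[a, b] \<cdot> (f \<boxplus> g) \<cdot> h = g \<cdot> \<p>\<^sub>2[Dom C f, Dom C g] \<cdot> h"
  using Comp_eq_extend [OF Proj_biprod_arr(1), of f g a b h]
    Comp_eq_extend [OF Proj_biprod_arr(2), of f g a b h] assms by auto

lemma Biprod_eqI:
  assumes "h \<in> Arr C" "k \<in> Arr C" "Dom C h = Dom C k" "Cod C h = a \<oplus> b" "Cod C k = a \<oplus> b"
    and "a \<in> Obj C" "b \<in> Obj C"
    and "\<p>\<^sub>1[a, b] \<cdot> h = \<p>\<^sub>1[a, b] \<cdot> k" "\<p>\<^sub>2[a, b] \<cdot> h = \<p>\<^sub>2[a, b] \<cdot> k"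
  shows "h = k"
  using Biprod_product [of "\<p>\<^sub>1[a, b] \<cdot> k" "Dom C k" a "\<p>\<^sub>2[a, b] \<cdot> k" b] assms
  by (auto simp: Hom_iff)

lemma copies4_Obj [simp]: "a \<in> Obj C \<Longrightarrow> copies4 C a \<in> Obj C"
  by (simp add: copies4_def)

lemma proj4_type [simp]:
  assumes "a \<in> Obj C"
  shows "proj4 C a i \<in> Arr C" "Dom C (proj4 C a i) = copies4 C a" "Cod C (proj4 C a i) = a"
  using assms by (auto simp: proj4_def copies4_def)

lemma copies4_eqI:
  assumes "h \<in> Arr C" "k \<in> Arr C" "Dom C h = Dom C k" "Cod C h = copies4 C a" "Cod C k = copies4 C a"
    and a: "a \<in> Obj C"
    and eq: "\<And>i. i \<in> {1..4} \<Longrightarrow> proj4 C a i \<cdot> h = proj4 C a i \<cdot> k"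
  shows "h = k"
proof -
  note t = assms(1-5) [unfolded copies4_def]
  show ?thesis
    apply (rule Biprod_eqI [where a = "(a \<oplus> a) \<oplus> a" and b = a])
            apply (use t a in simp_all)
     apply (rule Biprod_eqI [where a = "a \<oplus> a" and b = a])
             apply (use t a in simp_all)
      apply (rule Biprod_eqI [where a = a and b = a])
              apply (use t a eq [of 1] eq [of 2] eq [of 3] eq [of 4] in \<open>simp_all add: proj4_def\<close>)
    done
qed

context
  fixes f :: "nat \<Rightarrow> 'a" and a b :: 'o
  assumes f: "\<And>i. i \<in> {1..4} \<Longrightarrow> f i \<in> Hom C a b"
begin

text \<open>The first index is written \<open>Suc 0\<close>, the form to which the simplifier rewrites \<open>1\<close>.\<close>

lemma family4:
  "f (Suc 0) \<in> Arr C" "Dom C (f (Suc 0)) = a" "Cod C (f (Suc 0)) = b"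
  "f 2 \<in> Arr C" "Dom C (f 2) = a" "Cod C (f 2) = b"
  "f 3 \<in> Arr C" "Dom C (f 3) = a" "Cod C (f 3) = b"
  "f 4 \<in> Arr C" "Dom C (f 4) = a" "Cod C (f 4) = b"
  using f [of 1] f [of 2] f [of 3] f [of 4] by (simp_all add: Hom_iff)

lemma family4_Obj: "a \<in> Obj C" "b \<in> Obj C"
  using f [of 1] by (auto simp: Hom_iff)

lemma tuple4_type:
  "tuple4 C f \<in> Arr C" "Dom C (tuple4 C f) = a" "Cod C (tuple4 C f) = copies4 C b"
  using family4 by (simp_all add: tuple4_def copies4_def)

lemma proj4_tuple4:
  assumes "i \<in> {1..4}"
  shows "proj4 C b i \<cdot> tuple4 C f = f i"
proof -
  have "i = 1 \<or> i = 2 \<or> i = 3 \<or> i = 4" using assms by auto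
  then show ?thesis using family4 family4_Obj by (auto simp: proj4_def tuple4_def)
qed

lemma sum4_type:
  "sum4 C f \<in> Arr C" "Dom C (sum4 C f) = copies4 C a" "Cod C (sum4 C f) = copies4 C b"
  using family4 family4_Obj by (simp_all add: sum4_def copies4_def)

lemma proj4_sum4:
  assumes "i \<in> {1..4}"
  shows "proj4 C b i \<cdot> sum4 C f = f i \<cdot> proj4 C a i"
proof -
  have "i = 1 \<or> i = 2 \<or> i = 3 \<or> i = 4" using assms by auto
  then show ?thesis using family4 family4_Obj by (auto simp: proj4_def sum4_def)
qed

end

end

section \<open>Entanglement swapping\<close>

theorem mainTheorem4:
  fixes C :: "('o, 'a, 'm) dagger_compact_closed_biproduct_category_scheme" (structure)
    and Q :: 'o
    and \<beta> \<gamma> P :: "nat \<Rightarrow> 'a"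
    and \<upsilon> \<tau> \<Theta> \<phi> \<zeta> :: 'a
  assumes C: "dagger_compact_closed_biproduct_category C"
    and Q: "Q \<in> Obj C"
    and \<beta>: "\<And>i. i \<in> {1..4} \<Longrightarrow> \<beta> i \<in> Hom C Q Q \<and> unitary C (\<beta> i)"
    and \<gamma>: "\<And>i. i \<in> {1..4} \<Longrightarrow> \<gamma> i = lower_star C (\<beta> i)"
    and P: "\<And>i. i \<in> {1..4} \<Longrightarrow> P i = (\<w>[Q] \<boxtimes> \<one>[Q\<^sup>\<star>]) \<cdot> \<ulcorner>\<gamma> i\<urcorner> \<cdot> \<llcorner>\<beta> i\<lrcorner>"
    and \<upsilon>: "\<upsilon> = tuple4 C (\<lambda>i. proj4 C (Q \<otimes> Q\<^sup>\<star>) i \<boxtimes> \<one>[Q])"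
    and \<tau>: "\<tau> = tuple4 C (\<lambda>i. \<one>[Q\<^sup>\<star>] \<boxtimes> proj4 C ((Q \<otimes> Q\<^sup>\<star>) \<otimes> Q) i)"
    and \<Theta>: "\<Theta> = \<one>[Q\<^sup>\<star>] \<boxtimes> (tuple4 C P \<boxtimes> \<one>[Q])"
    and \<phi>: "\<phi> =
      sum4 C (\<lambda>_. (\<s>[Q, Q\<^sup>\<star>] \<boxtimes> \<one>[Q\<^sup>\<star> \<otimes> Q]) \<cdot> inv_arr C \<a>[Q \<otimes> Q\<^sup>\<star>, Q\<^sup>\<star>, Q]
        \<cdot> (\<s>[Q\<^sup>\<star>, Q \<otimes> Q\<^sup>\<star>] \<boxtimes> \<one>[Q]) \<cdot> \<a>[Q\<^sup>\<star>, Q \<otimes> Q\<^sup>\<star>, Q])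
      \<cdot> \<tau> \<cdot> (\<one>[Q\<^sup>\<star>] \<boxtimes> \<upsilon>)"
    and \<zeta>: "\<zeta> =
      sum4 C (\<lambda>i. (\<one>[Q\<^sup>\<star>] \<boxtimes> \<beta> i) \<boxtimes> (\<one>[Q\<^sup>\<star>] \<boxtimes> inv_arr C (\<beta> i)))"
  shows "let lhs = \<zeta> \<cdot> \<phi> \<cdot> \<Theta> \<cdot> (\<one>[Q\<^sup>\<star>] \<boxtimes> \<a>[Q, Q\<^sup>\<star>, Q])
          \<cdot> inv_arr C \<a>[Q\<^sup>\<star>, Q, Q\<^sup>\<star> \<otimes> Q] \<cdot> (\<ulcorner>\<one>[Q]\<urcorner> \<boxtimes> \<ulcorner>\<one>[Q]\<urcorner>);
        rhs = tuple4 C (\<lambda>_. \<ulcorner>\<one>[Q]\<urcorner> \<boxtimes> \<ulcorner>\<one>[Q]\<urcorner>)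
    in lhs \<in> Hom C (\<I> \<otimes> \<I>) (copies4 C ((Q\<^sup>\<star> \<otimes> Q) \<otimes> (Q\<^sup>\<star> \<otimes> Q)))
      \<and> lhs = rhs"
proof -
  interpret dagger_compact_closed_biproduct_category C by (rule C)
  define A where "A = Q\<^sup>\<star>"
  define X where "X = Q \<otimes> A"
  define S where "S = A \<otimes> (X \<otimes> Q)"
  define T where "T = (A \<otimes> Q) \<otimes> (A \<otimes> Q)"
  define z where "z i = (\<one>[A] \<boxtimes> \<beta> i) \<boxtimes> (\<one>[A] \<boxtimes> inv_arr C (\<beta> i))" for i
  define r where "r = (\<s>[Q, A] \<boxtimes> \<one>[A \<otimes> Q]) \<cdot> inv_arr C \<a>[X, A, Q]
        \<cdot> (\<s>[A, X] \<boxtimes> \<one>[Q]) \<cdot> \<a>[A, X, Q]"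
  define rest where "rest = (\<one>[A] \<boxtimes> \<a>[Q, A, Q]) \<cdot> inv_arr C \<a>[A, Q, A \<otimes> Q] \<cdot> (\<ulcorner>\<one>[Q]\<urcorner> \<boxtimes> \<ulcorner>\<one>[Q]\<urcorner>)"
  define s where "s = \<ulcorner>\<one>[Q]\<urcorner> \<boxtimes> \<ulcorner>\<one>[Q]\<urcorner>"
  have o: "Q \<in> Obj C" "A \<in> Obj C" "X \<in> Obj C" "S \<in> Obj C" "T \<in> Obj C" "Q\<^sup>\<star> = A" "Q \<otimes> A = X"
    using Q by (simp_all add: A_def X_def S_def T_def)
  have b: "\<beta> i \<in> Arr C" "Dom C (\<beta> i) = Q" "Cod C (\<beta> i) = Q" "unitary C (\<beta> i)"
    "inv_arr C (\<beta> i) \<in> Arr C" "Dom C (inv_arr C (\<beta> i)) = Q" "Cod C (inv_arr C (\<beta> i)) = Q"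
    if "i \<in> {1..4}" for i
    using \<beta> [OF that] inv_arr_props [of "\<beta> i"] by (auto simp: Hom_iff unitary_def iso_def)
  have fz: "z i \<in> Hom C T T" if "i \<in> {1..4}" for i
    using b [OF that] o by (simp add: z_def T_def Hom_iff)
  have fP: "P i \<in> Hom C X X" if "i \<in> {1..4}" for i
    using b [OF that] o P [OF that] \<gamma> [OF that] by (simp add: Hom_iff)
  have fr: "r \<in> Hom C S T"
    using o by (simp add: r_def S_def T_def Hom_iff)
  have fs: "s \<in> Hom C (\<I> \<otimes> \<I>) T"
    using o by (simp add: s_def T_def Hom_iff)
  have frest: "rest \<in> Hom C (\<I> \<otimes> \<I>) S"
    using o by (simp add: rest_def S_def Hom_iff)
  have fu: "proj4 C X i \<boxtimes> \<one>[Q] \<in> Hom C (copies4 C X \<otimes> Q) (X \<otimes> Q)" for i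
    using o by (simp add: Hom_iff)
  have ft: "\<one>[A] \<boxtimes> proj4 C (X \<otimes> Q) i \<in> Hom C (A \<otimes> copies4 C (X \<otimes> Q)) S" for i
    using o by (simp add: S_def Hom_iff)
  note types = tuple4_type [OF fP] tuple4_type [OF fu] tuple4_type [OF ft]
    sum4_type [OF fz] sum4_type [OF fr] tuple4_type [OF fs]
  have u: "\<upsilon> = tuple4 C (\<lambda>i. proj4 C X i \<boxtimes> \<one>[Q])"
    and t: "\<tau> = tuple4 C (\<lambda>i. \<one>[A] \<boxtimes> proj4 C (X \<otimes> Q) i)"
    and th: "\<Theta> = \<one>[A] \<boxtimes> (tuple4 C P \<boxtimes> \<one>[Q])"
    and ph: "\<phi> = sum4 C (\<lambda>_. r) \<cdot> \<tau> \<cdot> (\<one>[A] \<boxtimes> \<upsilon>)"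
    and ze: "\<zeta> = sum4 C z"
    unfolding \<upsilon> \<tau> \<Theta> \<phi> \<zeta> z_def r_def A_def X_def by (rule refl)+
  define lhs where "lhs = \<zeta> \<cdot> \<phi> \<cdot> \<Theta> \<cdot> rest"
  have typed: "\<upsilon> \<in> Arr C" "Dom C \<upsilon> = copies4 C X \<otimes> Q" "Cod C \<upsilon> = copies4 C (X \<otimes> Q)"
    "\<tau> \<in> Arr C" "Dom C \<tau> = A \<otimes> copies4 C (X \<otimes> Q)" "Cod C \<tau> = copies4 C S"
    "\<zeta> \<in> Arr C" "Dom C \<zeta> = copies4 C T" "Cod C \<zeta> = copies4 C T"
    "\<Theta> \<in> Arr C" "Dom C \<Theta> = S" "Cod C \<Theta> = A \<otimes> (copies4 C X \<otimes> Q)"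
    "rest \<in> Arr C" "Dom C rest = \<I> \<otimes> \<I>" "Cod C rest = S"
    "r \<in> Arr C" "Dom C r = S" "Cod C r = T"
    "s \<in> Arr C" "Dom C s = \<I> \<otimes> \<I>" "Cod C s = T"
    using types o frest fr fs unfolding u t ze th by (simp_all add: Hom_iff S_def)
  have typelhs: "lhs \<in> Hom C (\<I> \<otimes> \<I>) (copies4 C T)"
    using typed types o by (simp add: lhs_def ph Hom_iff)
  have "lhs = tuple4 C (\<lambda>_. s)"
  proof (rule copies4_eqI [of _ _ T])
    fix i :: nat
    assume i: "i \<in> {1..4}"
    have bi: "z i \<in> Arr C" "Dom C (z i) = T" "P i \<in> Arr C" "Dom C (P i) = X" "Cod C (P i) = X"
      using fz [OF i] fP [OF i] by (simp_all add: Hom_iff)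
    have pu: "proj4 C (X \<otimes> Q) i \<cdot> \<upsilon> = proj4 C X i \<boxtimes> \<one>[Q]"
      unfolding u by (rule proj4_tuple4 [OF fu i])
    have pt: "proj4 C S i \<cdot> \<tau> = \<one>[A] \<boxtimes> proj4 C (X \<otimes> Q) i"
      unfolding t by (rule proj4_tuple4 [OF ft i])
    have "proj4 C T i \<cdot> lhs = z i \<cdot> proj4 C T i \<cdot> \<phi> \<cdot> \<Theta> \<cdot> rest"
      using Comp_eq_extend [OF proj4_sum4 [OF fz i], where h = "\<phi> \<cdot> \<Theta> \<cdot> rest"] types typed o bi
      by (simp add: lhs_def ze ph)
    also have "\<dots> = z i \<cdot> r \<cdot> proj4 C S i \<cdot> \<tau> \<cdot> (\<one>[A] \<boxtimes> \<upsilon>) \<cdot> \<Theta> \<cdot> rest"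
      using Comp_eq_extend [OF proj4_sum4 [OF fr i], where h = "\<tau> \<cdot> (\<one>[A] \<boxtimes> \<upsilon>) \<cdot> \<Theta> \<cdot> rest"] types typed o bi
      by (simp add: ph)
    also have "\<dots> = z i \<cdot> r \<cdot> (\<one>[A] \<boxtimes> proj4 C (X \<otimes> Q) i) \<cdot> (\<one>[A] \<boxtimes> \<upsilon>) \<cdot> \<Theta> \<cdot> rest"
      using Comp_eq_extend [OF pt, where h = "(\<one>[A] \<boxtimes> \<upsilon>) \<cdot> \<Theta> \<cdot> rest"] typed o by simp
    also have "\<dots> = z i \<cdot> r \<cdot> (\<one>[A] \<boxtimes> (proj4 C X i \<boxtimes> \<one>[Q])) \<cdot> \<Theta> \<cdot> rest"
      using pu typed o by (simp add: interchange_extend)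
    also have "\<dots> = z i \<cdot> r \<cdot> (\<one>[A] \<boxtimes> (P i \<boxtimes> \<one>[Q])) \<cdot> rest"
      using proj4_tuple4 [OF fP i] types typed o by (simp add: th S_def interchange_extend interchange)
    also have "\<dots> = s"
      using swapping_branch [OF o(1) b(1-4) [OF i]]
      unfolding z_def r_def rest_def s_def P [OF i] \<gamma> [OF i] by (simp only: o(6,7))
    also have "\<dots> = proj4 C T i \<cdot> tuple4 C (\<lambda>_. s)"
      by (rule proj4_tuple4 [OF fs i, symmetric])
    finally show "proj4 C T i \<cdot> lhs = proj4 C T i \<cdot> tuple4 C (\<lambda>_. s)" .
  qed (use typelhs types o in \<open>auto simp: Hom_iff\<close>)
  with typelhs show ?thesis
    unfolding Let_def lhs_def rest_def s_def T_def A_def by simp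
qed

end
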